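(* Let $n\in\mathbb{N}$ and $I=\{i_1<\dots<i_l\}\subseteq[n-1]_0$. Then $$\sum_{w\in B_n,\ D(w)\subseteq I}(-1)^{l(w)}X^{L(w)}=f_{n,I}(X)$$ holds in each of the following cases: (1) $n\in\mathbb{N}$ arbitrary and $I=\{0\}$; (2) $n\in\mathbb{N}$ arbitrary and $I=[n-1]_0$; (3) $n$ is even and $I\subseteq[n-1]_0\cap 2\mathbb{Z}$.
   Context: For $n\in\mathbb{N}$ let $[n]=\{1,\dots,n\}$, $[n]_0=\{0\}\cup[n]$, $[\pm n]_0=\{-n,\dots,n\}$. The hyperoctahedral group $B_n$ is the group of permutations $w$ of $[\pm n]_0$ with $w(-j)=-w(j)$ for all $j$ (so $w(0)=0$). For $w\in B_n$ let $\mathrm{inv}(w)=\#\{(i,j)\in[n]^2: i<j,\ w(i)>w(j)\}$, $\mathrm{neg}(w)=\#\{i\in[n]: w(i)<0\}$, $\mathrm{nsp}(w)=\#\{\{i,j\}\subseteq[n]: i\ne j,\ w(i)+w(j)<0\}$, and $l(w)=\mathrm{inv}(w)+\mathrm{neg}(w)+\mathrm{nsp}(w)$ (the Coxeter length with respect to the generators $s_0=[-1,2,\dots,n]$, $s_i$ swapping $i,i+1$). The descent set is $D(w)=\{i\in[n-1]_0: w(i)>w(i+1)\}$. Define $$L(w)=\tfrac12\#\{(i,j)\in[\pm n]_0^2: i<j,\ w(i)>w(j),\ i\not\equiv j \pmod 2\}.$$ For an indeterminate $X$ write $(\underline{m})=1-X^m$ for $m\ge1$, $(\underline{0})=1$,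 and $(\underline{m})!=(\underline{1})(\underline{2})\cdots(\underline{m})$. For $I=\{i_1<\dots<i_l\}\subseteq[n-1]_0$ put $i_1=\min(I\cup\{n\})$ and $i_{l+1}=n$, and define $$f_{n,I}(X)=\frac{(\underline{n})!}{(\underline{i_1})!}\prod_{r=1}^{l}\prod_{\sigma=1}^{\lfloor (i_{r+1}-i_r)/2\rfloor}(\underline{2\sigma})^{-1}\in\mathbb{Z}[X].$$ *)

theory Defs
  imports
    "HOL-Combinatorics.Permutations"
    "HOL-Computational_Algebra.Polynomial_Factorial"
begin

(* An element of the hyperoctahedral group is a map on all of int that is the identity
   outside {-n..n}, so that distinct maps are distinct group elements. *)
definition hyperoct :: "nat \<Rightarrow> (int \<Rightarrow> int) set" where
  "hyperoct n = {w. w permutes {- int n..int n} \<and> (\<forall>j\<in>{- int n..int n}. w (- j) = - w j)}"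

definition inv_stat :: "nat \<Rightarrow> (int \<Rightarrow> int) \<Rightarrow> nat" where
  "inv_stat n w = card {(i, j). i \<in> {1..int n} \<and> j \<in> {1..int n} \<and> i < j \<and> w i > w j}"

definition neg_stat :: "nat \<Rightarrow> (int \<Rightarrow> int) \<Rightarrow> nat" where
  "neg_stat n w = card {i \<in> {1..int n}. w i < 0}"

definition nsp_stat :: "nat \<Rightarrow> (int \<Rightarrow> int) \<Rightarrow> nat" where
  "nsp_stat n w =
     card {{i, j} | i j. i \<in> {1..int n} \<and> j \<in> {1..int n} \<and> i \<noteq> j \<and> w i + w j < 0}"

definition cox_length :: "nat \<Rightarrow> (int \<Rightarrow> int) \<Rightarrow> nat" where
  "cox_length n w = inv_stat n w + neg_stat n w + nsp_stat n w"

definition descent_set :: "nat \<Rightarrow> (int \<Rightarrow> int) \<Rightarrow> nat set" where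
  "descent_set n w = {i \<in> {0..n - 1}. w (int i) > w (int i + 1)}"

definition odd_inversions :: "nat \<Rightarrow> (int \<Rightarrow> int) \<Rightarrow> (int \<times> int) set" where
  "odd_inversions n w =
     {(i, j). i \<in> {- int n..int n} \<and> j \<in> {- int n..int n} \<and>
              i < j \<and> w i > w j \<and> i mod 2 \<noteq> j mod 2}"

(* The division by 2 is exact on hyperoct n, see even_card_odd_inversions below. *)
definition L_stat :: "nat \<Rightarrow> (int \<Rightarrow> int) \<Rightarrow> nat" where
  "L_stat n w = card (odd_inversions n w) div 2"

definition und :: "nat \<Rightarrow> int poly" where
  "und m = (if m = 0 then 1 else 1 - monom 1 m)"

definition und_fact :: "nat \<Rightarrow> int poly" where
  "und_fact m = (\<Prod>k=1..m. und k)"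

(* The list i_1, ..., i_l, i_{l+1} = n, indexed from 0. Its head is Min (I \<union> {n})
   for I \<subseteq> {0..n - 1}, also when I is empty. *)
definition idx_list :: "nat \<Rightarrow> nat set \<Rightarrow> nat list" where
  "idx_list n I = sorted_list_of_set I @ [n]"

(* A rational function: the quotient is formed in the fraction field of Z[X], so that no
   divisibility is presupposed. *)
definition f_poly :: "nat \<Rightarrow> nat set \<Rightarrow> int poly fract" where
  "f_poly n I =
     to_fract (und_fact n) / to_fract (und_fact (Min (I \<union> {n}))) *
     (\<Prod>r<card I. \<Prod>s=1..(idx_list n I ! Suc r - idx_list n I ! r) div 2.
        inverse (to_fract (und (2 * s))))"

lemma finite_hyperoct: "finite (hyperoct n)"
  by (rule finite_subset[OF _ finite_permutations[of "{- int n..int n}"]])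
     (auto simp: hyperoct_def)

lemma even_card_odd_inversions:
  assumes "w \<in> hyperoct n"
  shows "even (card (odd_inversions n w))"
proof -
  let ?S = "odd_inversions n w"
  let ?P = "{(i, j) \<in> ?S. i + j > 0}" and ?N = "{(i, j) \<in> ?S. i + j < 0}"
  have neg: "w (- j) = - w j" if "j \<in> {- int n..int n}" for j
    using assms that by (auto simp: hyperoct_def)
  have fin: "finite ?S"
    by (rule finite_subset[of _ "{- int n..int n} \<times> {- int n..int n}"])
       (auto simp: odd_inversions_def)
  have nz: "i + j \<noteq> 0" if "(i, j) \<in> ?S" for i j
  proof -
    have "i mod 2 \<noteq> j mod 2" using that by (simp add: odd_inversions_def)
    then show ?thesis by presburger
  qed
  have flip: "(- j, - i) \<in> ?S" if "(i, j) \<in> ?S" for i j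
  proof -
    have "i mod 2 \<noteq> j mod 2" using that by (simp add: odd_inversions_def)
    then have "(- j) mod 2 \<noteq> (- i) mod 2" by presburger
    then show ?thesis using that neg by (auto simp: odd_inversions_def)
  qed
  have "bij_betw (\<lambda>(i, j). (- j, - i)) ?P ?N"
    by (rule bij_betw_byWitness[where f' = "\<lambda>(i, j). (- j, - i)"]) (auto intro: flip)
  then have eq: "card ?P = card ?N" by (rule bij_betw_same_card)
  have "?P \<union> ?N = ?S" using nz by (auto simp: linorder_neq_iff)
  then have "card ?S = card (?P \<union> ?N)" by (rule arg_cong[OF sym])
  also have "\<dots> = card ?P + card ?N"
  proof (rule card_Un_disjoint)
    show "finite ?P" and "finite ?N"
      by (rule finite_subset[OF _ fin], blast)+
    show "?P \<inter> ?N = {}" by auto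
  qed
  also have "\<dots> = 2 * card ?N" by (simp only: eq mult_2)
  finally show ?thesis by (rule ssubst) (rule dvd_triv_left)
qed

end

theory Submission
  imports Defs
begin

text \<open>
  The formula holds for every \<open>I\<close>. If \<open>k\<close> is the largest element of \<open>I\<close>, every \<open>w\<close> factors uniquely as
  \<open>w = u v\<close> with \<open>u\<close> increasing on \<open>[-k, k]\<close> and on \<open>(k, n]\<close>, and \<open>v \<in> B\<^sub>k\<close>. For fixed \<open>u\<close>, a
  sign-reversing involution, exchanging two consecutive values of \<open>v\<close> at positions of equal parity, cancels
  all \<open>v\<close> that do not preserve parity, and \<open>L(u v) = L(u) + L(v)\<close> for the remaining ones. Hence the
  generating polynomial of \<open>(n, I)\<close> is the product of those of \<open>(n, {k})\<close> and \<open>(k, I - {k})\<close>. The case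
  \<open>I = {k}\<close> is solved by a recursion that deletes the entry \<open>\<plusminus>n\<close>; it closes up once a variant of \<open>L\<close>,
  with the parities of the positions beyond \<open>k\<close> flipped, is treated simultaneously.
\<close>

text \<open>Only \<open>L\<close> obstructs the factorisation w = u v. Length is additive for every
  \<open>v\<close>, but a pair (i, j) with |i| <= k < j enters \<open>L\<close> through the parity
  of the position i, and \<open>v\<close> moves that position. If \<open>v\<close> breaks parity,
  the positions of the values 0, 1, ..., k cannot alternate in parity, because 0 sits at position 0;
  so some t and t + 1 sit at positions of equal parity. Exchanging them (for t = 0: changing the
  sign of the values 1 and -1) is the same as first applying a parity-preserving permutation of the
  positions, so \<open>L\<close> of the product stays while the length changes parity. Neighbouring
  positions have opposite parity, so no descent appears or disappears.

  In the recursion for a single descent, the twisted sum vanishes whenever the second run has odd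
  length; together with the power of X that it leaves for even length, this makes the recursion
  collapse to a product.\<close>

section \<open>Length and \<open>L\<close> as counts over one set of pairs\<close>

text \<open>For i < j, the condition |i| < j says i + j > 0. It picks one pair from each two-element
  orbit of (i, j) -> (-j, -i), so \<open>L\<close> needs no halving. The relation \<open>R\<close>
  lets the same set serve for the length (no condition) and for \<open>L\<close> (opposite
  parity).\<close>

definition inv_pairs :: "nat \<Rightarrow> (int \<Rightarrow> int \<Rightarrow> bool) \<Rightarrow> (int \<Rightarrow> int) \<Rightarrow> (int \<times> int) set" where
  "inv_pairs n R w = {(i, j). \<bar>i\<bar> < j \<and> j \<le> int n \<and> w j < w i \<and> R i j}"

lemma finite_inv_pairs [simp]: "finite (inv_pairs n R w)"
  by (rule finite_subset[of _ "{- int n..int n} \<times> {- int n..int n}"]) (auto simp: inv_pairs_def)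

lemma hyperoct_permutes: "w \<in> hyperoct n \<Longrightarrow> w permutes {- int n..int n}"
  by (simp add: hyperoct_def)

lemma hyperoct_outside: "w \<in> hyperoct n \<Longrightarrow> int n < \<bar>i\<bar> \<Longrightarrow> w i = i"
  using hyperoct_permutes[of w n] by (intro permutes_not_in[of w]) auto

lemma hyperoct_minus: "w \<in> hyperoct n \<Longrightarrow> w (- i) = - w i"
  by (cases "i \<in> {- int n..int n}") (simp add: hyperoct_def, auto simp: hyperoct_outside)

lemma hyperoct_zero: "w \<in> hyperoct n \<Longrightarrow> w 0 = 0"
  using hyperoct_minus[of w n 0] by simp

lemma hyperoct_abs_le_iff: "w \<in> hyperoct n \<Longrightarrow> \<bar>w i\<bar> \<le> int n \<longleftrightarrow> \<bar>i\<bar> \<le> int n"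
  using permutes_in_image[OF hyperoct_permutes, of w n i] by (auto simp: abs_le_iff)

lemma hyperoct_eq_iff: "w \<in> hyperoct n \<Longrightarrow> w i = w j \<longleftrightarrow> i = j"
  using permutes_inj[OF hyperoct_permutes] by (auto simp: inj_def)

text \<open>
  The pairs \<open>(i, j)\<close> with \<open>i > 0\<close>, \<open>i = 0\<close> and \<open>i < 0\<close> are counted by \<open>inv\<close>, \<open>neg\<close> and \<open>nsp\<close>.
\<close>

lemma cox_length_eq_card_inv_pairs:
  assumes "w \<in> hyperoct n"
  shows "cox_length n w = card (inv_pairs n (\<lambda>_ _. True) w)"
proof -
  note m = hyperoct_minus[OF assms] and z = hyperoct_zero[OF assms]
  let ?T = "inv_pairs n (\<lambda>_ _. True) w"
  let ?P = "{(i, j) \<in> ?T. 0 < i}" and ?Z = "{(i, j) \<in> ?T. i = 0}" and ?N = "{(i, j) \<in> ?T. i < 0}"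
  have fin: "finite ?P" "finite ?Z" "finite ?N"
    by (rule finite_subset[OF _ finite_inv_pairs[of n "\<lambda>_ _. True" w]], blast)+
  have "inv_stat n w = card ?P"
    unfolding inv_stat_def by (rule arg_cong[where f = card]) (auto simp: inv_pairs_def)
  moreover have "neg_stat n w = card ?Z"
    unfolding neg_stat_def
    by (rule bij_betw_same_card[of "\<lambda>j. (0, j)"], rule bij_betw_byWitness[where f' = snd])
       (auto simp: inv_pairs_def z)
  moreover have "nsp_stat n w = card ?N"
  proof -
    have "bij_betw (\<lambda>(i, j). {- i, j}) ?N
       {{i, j} | i j. i \<in> {1..int n} \<and> j \<in> {1..int n} \<and> i \<noteq> j \<and> w i + w j < 0}" (is "bij_betw ?f _ ?S")
    proof (rule bij_betw_imageI)
      show "inj_on ?f ?N"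
        by (auto simp: inj_on_def inv_pairs_def doubleton_eq_iff)
      show "?f ` ?N = ?S"
      proof (intro subset_antisym subsetI)
        fix s assume "s \<in> ?f ` ?N"
        then obtain i j where "s = {- i, j}" "(i, j) \<in> ?N" by auto
        then have "s = {- i, j} \<and> - i \<in> {1..int n} \<and> j \<in> {1..int n} \<and> - i \<noteq> j \<and> w (- i) + w j < 0"
          by (auto simp: inv_pairs_def m)
        then show "s \<in> ?S" by blast
      next
        fix s assume "s \<in> ?S"
        then obtain i j where s: "s = {i, j}" "i \<in> {1..int n}" "j \<in> {1..int n}" "i < j" "w i + w j < 0"
          by (smt (verit) add.commute insert_commute linorder_neqE mem_Collect_eq)
        then show "s \<in> ?f ` ?N"
          by (intro image_eqI[of _ _ "(- i, j)"]) (auto simp: inv_pairs_def m)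
      qed
    qed
    then show ?thesis unfolding nsp_stat_def by (simp add: bij_betw_same_card)
  qed
  moreover have "card ?T = card ?P + card ?Z + card ?N"
  proof -
    have "card (?P \<union> ?Z \<union> ?N) = card (?P \<union> ?Z) + card ?N"
      using fin by (intro card_Un_disjoint) auto
    moreover have "card (?P \<union> ?Z) = card ?P + card ?Z"
      using fin by (intro card_Un_disjoint) auto
    moreover have "?T = ?P \<union> ?Z \<union> ?N" by auto
    ultimately show ?thesis by simp
  qed
  ultimately show ?thesis by (simp add: cox_length_def)
qed

text \<open>Positions of opposite parity never satisfy i + j = 0, so (i, j) -> (-j, -i) has no fixed
  point on the odd inversions, and each orbit has one member with |i| < j.\<close>

lemma L_stat_eq_card_inv_pairs:
  assumes "w \<in> hyperoct n"
  shows "L_stat n w = card (inv_pairs n (\<lambda>i j. odd (i + j)) w)"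
proof -
  note m = hyperoct_minus[OF assms]
  let ?P = "inv_pairs n (\<lambda>i j. odd (i + j)) w"
  let ?f = "\<lambda>(i::int, j::int). (- j, - i)"
  have "odd_inversions n w = ?P \<union> ?f ` ?P"
  proof (intro subset_antisym subsetI)
    fix x assume x: "x \<in> odd_inversions n w"
    obtain i j where ij: "x = (i, j)" by (cases x)
    have "i + j \<noteq> 0" "odd (i + j)"
      using x unfolding ij odd_inversions_def by (auto, presburger+)
    then consider "i + j > 0" | "i + j < 0" by linarith
    then show "x \<in> ?P \<union> ?f ` ?P"
    proof cases
      case 1
      then have "x \<in> ?P" using x \<open>odd (i + j)\<close> by (auto simp: ij odd_inversions_def inv_pairs_def)
      then show ?thesis ..
    next
      case 2
      have "x = ?f (- j, - i)" by (simp add: ij)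
      moreover have "(- j, - i) \<in> ?P"
        using 2 x \<open>odd (i + j)\<close> by (auto simp: ij odd_inversions_def inv_pairs_def m)
      ultimately show ?thesis by blast
    qed
  next
    fix x assume "x \<in> ?P \<union> ?f ` ?P"
    then show "x \<in> odd_inversions n w"
      by (auto simp: odd_inversions_def inv_pairs_def m)
  qed
  moreover have "card (?P \<union> ?f ` ?P) = card ?P + card (?f ` ?P)"
    by (rule card_Un_disjoint) (simp, simp, auto simp: inv_pairs_def)
  moreover have "card (?f ` ?P) = card ?P"
    by (rule card_image) (auto simp: inj_on_def)
  ultimately show ?thesis by (simp add: L_stat_def)
qed


section \<open>Membership and closure in the hyperoctahedral group\<close>

lemma hyperoctI:
  assumes "w permutes {- int n..int n}" "\<And>i. \<bar>i\<bar> \<le> int n \<Longrightarrow> w (- i) = - w i"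
  shows "w \<in> hyperoct n"
  using assms by (auto simp: hyperoct_def)

lemma hyperoctI_inj:
  assumes "\<And>i. \<bar>i\<bar> \<le> int n \<Longrightarrow> \<bar>w i\<bar> \<le> int n"
    and inj: "\<And>i j. \<bar>i\<bar> \<le> int n \<Longrightarrow> \<bar>j\<bar> \<le> int n \<Longrightarrow> w i = w j \<Longrightarrow> i = j"
    and "\<And>i. \<bar>i\<bar> > int n \<Longrightarrow> w i = i" "\<And>i. \<bar>i\<bar> \<le> int n \<Longrightarrow> w (- i) = - w i"
  shows "w \<in> hyperoct n"
proof (rule hyperoctI)
  let ?S = "{- int n..int n}"
  have S: "i \<in> ?S \<longleftrightarrow> \<bar>i\<bar> \<le> int n" for i by auto
  have "bij_betw w ?S ?S"
  proof (rule bij_betw_imageI)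
    show "inj_on w ?S" by (rule inj_onI) (rule inj, simp_all only: S)
    then show "w ` ?S = ?S"
      by (intro endo_inj_surj image_subsetI) (simp_all only: S assms(1) finite_atLeastAtMost_int)
  qed
  then show "w permutes ?S"
    by (rule bij_imp_permutes) (simp only: S not_le assms(3))
qed (rule assms(4))

lemma id_hyperoct: "id \<in> hyperoct n"
  by (rule hyperoctI) (auto simp: permutes_id)

lemma comp_hyperoct:
  assumes "u \<in> hyperoct n" "v \<in> hyperoct k" "k \<le> n"
  shows "u \<circ> v \<in> hyperoct n"
proof (rule hyperoctI)
  have "v permutes {- int n..int n}"
    using assms by (intro permutes_subset[OF hyperoct_permutes[of v k]]) auto
  then show "u \<circ> v permutes {- int n..int n}"
    using hyperoct_permutes[OF assms(1)] by (rule permutes_compose)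
qed (simp add: hyperoct_minus[OF assms(1)] hyperoct_minus[OF assms(2)])

lemma inv_hyperoct:
  assumes "v \<in> hyperoct k"
  shows "inv v \<in> hyperoct k"
proof (rule hyperoctI)
  note p = hyperoct_permutes[OF assms]
  show "inv v permutes {- int k..int k}" by (rule permutes_inv[OF p])
  fix i
  have "v (inv v i) = i" "v (inv v (- i)) = - i"
    using permutes_inverses(1)[OF p] by auto
  then have "v (- inv v i) = v (inv v (- i))"
    by (simp add: hyperoct_minus[OF assms])
  then show "inv v (- i) = - inv v i"
    using hyperoct_eq_iff[OF assms] by metis
qed

section \<open>Descent classes and increasing runs\<close>

definition weight :: "nat \<Rightarrow> (int \<Rightarrow> int) \<Rightarrow> int poly" where
  "weight n w = (- 1) ^ cox_length n w * monom 1 (L_stat n w)"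

definition desc_within :: "nat \<Rightarrow> nat set \<Rightarrow> (int \<Rightarrow> int) set" where
  "desc_within n I = {w \<in> hyperoct n. \<forall>i<n. i \<notin> I \<longrightarrow> w (int i) < w (int i + 1)}"

lemma desc_within_eq: "desc_within n I = {w \<in> hyperoct n. descent_set n w \<subseteq> I}"
proof -
  have "(\<forall>i<n. i \<notin> I \<longrightarrow> w (int i) < w (int i + 1)) \<longleftrightarrow> descent_set n w \<subseteq> I"
    if w: "w \<in> hyperoct n" for w
  proof -
    have "w (int i) \<noteq> w (int i + 1)" for i
      using hyperoct_eq_iff[OF w] by simp
    then have "w (int i) < w (int i + 1) \<longleftrightarrow> w (int i) \<le> w (int i + 1)" for i
      by (simp add: order_less_le)
    \<comment> \<open>For n = 0 truncated subtraction leaves position 0 in the range of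
      \<open>descent_set\<close>; the identity has no descent there.\<close>
    moreover have "w 0 = 0" "n = 0 \<Longrightarrow> w 1 = 1"
      using w by (auto simp: hyperoct_zero hyperoct_outside)
    ultimately show ?thesis
      by (cases n) (auto simp: descent_set_def less_Suc_eq_le subset_iff not_less)
  qed
  then show ?thesis by (auto simp: desc_within_def)
qed

lemma finite_desc_within [simp]: "finite (desc_within n I)"
  by (rule finite_subset[OF _ finite_hyperoct]) (auto simp: desc_within_def)

lemma ascending_run:
  fixes w :: "int \<Rightarrow> int"
  assumes "\<And>i. a \<le> i \<Longrightarrow> i < b \<Longrightarrow> w i < w (i + 1)"
  shows "strict_mono_on {a..b} w"
proof (rule strict_mono_onI)
  fix i j assume ij: "i \<in> {a..b}" "j \<in> {a..b}" "i < j"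
  have "j \<le> b \<longrightarrow> w i < w j"
    using \<open>i < j\<close>
  proof (induction j rule: int_gr_induct)
    case base show ?case using assms[of i] ij by auto
  next
    case (step j) then show ?case using assms[of j] ij by auto
  qed
  then show "w i < w j" using ij by auto
qed

lemma strict_mono_on_symmetric:
  assumes w: "w \<in> hyperoct n" and m: "strict_mono_on {0..a} w"
  shows "strict_mono_on {-a..a} w"
proof (rule strict_mono_onI)
  have pos: "w i < w j" if "0 \<le> i" "i < j" "j \<le> a" for i j
    using strict_mono_onD[OF m, of i j] that by auto
  fix i j assume ij: "i \<in> {-a..a}" "j \<in> {-a..a}" "i < j"
  consider "0 \<le> i" | "j \<le> 0" | "i < 0" "0 < j" using ij by linarith
  then show "w i < w j"
  proof cases
    case 1 then show ?thesis using pos ij by auto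
  next
    case 2 then show ?thesis using pos[of "-j" "-i"] ij by (auto simp: hyperoct_minus[OF w])
  next
    case 3 then show ?thesis using pos[of 0 j] pos[of 0 "-i"] ij
      by (auto simp: hyperoct_minus[OF w] hyperoct_zero[OF w])
  qed
qed

lemma desc_within_ascends:
  assumes "w \<in> desc_within n I" "0 \<le> i" "i < int n" "nat i \<notin> I"
  shows "w i < w (i + 1)"
  using assms by (auto simp: desc_within_def dest!: spec[of _ "nat i"])

text \<open>With its only possible descent at k, such a w increases from w(0) = 0 up to position k,
  and oddness reflects this to the negative side. These are the elements u of the
  factorisation.\<close>

lemma desc_within_strict_mono_on:
  assumes "w \<in> desc_within n {k}" "k \<le> n"
  shows "strict_mono_on {- int k..int k} w"
proof (rule strict_mono_on_symmetric)
  show "w \<in> hyperoct n" using assms by (simp add: desc_within_def)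
  show "strict_mono_on {0..int k} w"
    using assms by (intro ascending_run desc_within_ascends[OF assms(1)]) auto
qed

subsection \<open>Factorisation along a descent\<close>

definition outer_pairs :: "nat \<Rightarrow> nat \<Rightarrow> (int \<Rightarrow> int \<Rightarrow> bool) \<Rightarrow> (int \<Rightarrow> int) \<Rightarrow> (int \<times> int) set" where
  "outer_pairs k n R w = {(i, j) \<in> inv_pairs n R w. int k < j}"

lemma finite_outer_pairs [simp]: "finite (outer_pairs k n R w)"
  by (rule finite_subset[OF _ finite_inv_pairs[of n R w]]) (auto simp: outer_pairs_def)

text \<open>For j > k, \<open>v\<close> permutes the positions i with |i| < j and fixes j. The
  hypothesis on \<open>R\<close> is automatic for the length; for \<open>L\<close> it demands that
  \<open>v\<close> preserve parity.\<close>

lemma card_outer_pairs_comp: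
  assumes v: "v \<in> hyperoct k" and R: "\<And>i j. R (v i) j = R i j"
  shows "card (outer_pairs k n R (w \<circ> v)) = card (outer_pairs k n R w)"
proof (rule bij_betw_same_card)
  note p = permutes_inverses[OF hyperoct_permutes[OF v]]
  note iv = inv_hyperoct[OF v]
  have abs: "\<bar>x i\<bar> < j \<longleftrightarrow> \<bar>i\<bar> < j" if "int k < j" "x \<in> hyperoct k" for x i j
    using hyperoct_abs_le_iff[OF that(2), of i] hyperoct_outside[OF that(2), of i] that(1)
    by (cases "\<bar>i\<bar> \<le> int k") auto
  have R': "R (inv v i) j = R i j" for i j using R[of "inv v i" j] p by simp
  have out: "v j = j" "inv v j = j" if "int k < j" for j
    using that hyperoct_outside[OF v] hyperoct_outside[OF iv] by auto
  show "bij_betw (\<lambda>(i, j). (v i, j)) (outer_pairs k n R (w \<circ> v)) (outer_pairs k n R w)"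
    by (rule bij_betw_byWitness[where f' = "\<lambda>(i, j). (inv v i, j)"])
       (auto simp: outer_pairs_def inv_pairs_def abs[OF _ v] abs[OF _ iv] R R' p out)
qed

text \<open>Since \<open>u\<close> increases on [-k, k], the pairs inside that interval are inverted
  by u v exactly when \<open>v\<close> inverts them.\<close>

lemma card_inv_pairs_comp:
  assumes u: "u \<in> desc_within n {k}" and v: "v \<in> hyperoct k" and kn: "k \<le> n"
  shows "card (inv_pairs n R (u \<circ> v)) = card (inv_pairs k R v) + card (outer_pairs k n R (u \<circ> v))"
proof -
  note m = strict_mono_on_less[OF desc_within_strict_mono_on[OF u kn]]
  have "v i \<in> {- int k..int k}" if "\<bar>i\<bar> \<le> int k" for i
    using that hyperoct_abs_le_iff[OF v, of i] by (simp add: abs_le_iff)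
  then have "u (v j) < u (v i) \<longleftrightarrow> v j < v i" if "\<bar>i\<bar> < j" "j \<le> int k" for i j
    using that by (intro m) simp_all
  then have "inv_pairs n R (u \<circ> v) = inv_pairs k R v \<union> outer_pairs k n R (u \<circ> v)"
    using kn by (auto simp: inv_pairs_def outer_pairs_def) (metis not_less)
  then show ?thesis
    by (simp only:) (rule card_Un_disjoint, simp, simp, auto simp: inv_pairs_def outer_pairs_def)
qed

lemma card_inv_pairs_comp_factor:
  assumes u: "u \<in> desc_within n {k}" and v: "v \<in> hyperoct k" and kn: "k \<le> n"
    and R: "\<And>i j. R (v i) j = R i j"
  shows "card (inv_pairs n R (u \<circ> v)) = card (inv_pairs k R v) + card (inv_pairs n R u)"
proof -
  \<comment> \<open>Taking \<open>v = id\<close> in the splitting shows that all inversions of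
    \<open>u\<close> are outer ones.\<close>
  have "inv_pairs k R id = {}" by (auto simp: inv_pairs_def)
  then show ?thesis
    using card_inv_pairs_comp[OF u v kn, of R] card_outer_pairs_comp[OF v, of R, OF R]
      card_inv_pairs_comp[OF u id_hyperoct kn, of R] by simp
qed


section \<open>Coxeter generators acting on values\<close>

text \<open>The generator s_t, extended by the identity to all integers. It will be composed on the
  left, so it exchanges values, not positions; \<open>sgn\<close> treats the values and their
  negatives together.\<close>

definition simple_refl :: "nat \<Rightarrow> int \<Rightarrow> int" where
  "simple_refl t x =
    (if t = 0 then (if \<bar>x\<bar> = 1 then - x else x)
     else if \<bar>x\<bar> = int t then x + sgn x
     else if \<bar>x\<bar> = int t + 1 then x - sgn x else x)"

lemma simple_refl_simple_refl [simp]: "simple_refl t (simple_refl t x) = x"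
  by (auto simp: simple_refl_def sgn_if abs_if split: if_splits)

lemma simple_refl_minus: "simple_refl t (- x) = - simple_refl t x"
  by (auto simp: simple_refl_def sgn_if)

lemma simple_refl_hyperoct: "t < k \<Longrightarrow> simple_refl t \<in> hyperoct k"
proof (rule hyperoctI)
  assume "t < k"
  then show "simple_refl t permutes {- int k..int k}"
    by (intro bij_imp_permutes bij_betw_byWitness[where f' = "simple_refl t"])
       (auto simp: simple_refl_def sgn_if abs_if split: if_splits)
qed (rule simple_refl_minus)

text \<open>A generator reverses only comparisons between neighbours t, t + 1 or their negatives.
  For t = 0 these compare 0 with 1 or -1; the comparison of 1 with -1, which s_0 also reverses, is
  excluded by x \<noteq> - y.\<close>

lemma simple_refl_less_iff:
  assumes "x \<noteq> y" "x \<noteq> - y"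
  shows "(simple_refl t x < simple_refl t y \<longleftrightarrow> x < y) \<longleftrightarrow>
    \<not> (x = int t \<and> y = int t + 1 \<or> x = int t + 1 \<and> y = int t \<or> 
       x = - int t \<and> y = - int t - 1 \<or> x = - int t - 1 \<and> y = - int t)"
  using assms by (cases "t = 0") (auto simp: simple_refl_def sgn_if abs_if split: if_splits)

lemma odd_hyperoct_abs: "v \<in> hyperoct k \<Longrightarrow> odd (v \<bar>x\<bar>) \<longleftrightarrow> odd (v x)"
  by (auto simp: abs_if hyperoct_minus)

text \<open>The generator only exchanges the positions of t and t + 1 up to sign, and these have
  equal parity. Hence the swap leaves the parity of the position of every value alone.\<close>

lemma odd_inv_simple_refl:
  assumes v: "v \<in> hyperoct k" and t: "odd (inv v (int t)) = odd (inv v (int t + 1))"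
  shows "odd (inv v (simple_refl t x)) = odd (inv v x)"
proof -
  have "\<bar>simple_refl t x\<bar> = (if t = 0 then \<bar>x\<bar> else if \<bar>x\<bar> = int t then int t + 1
      else if \<bar>x\<bar> = int t + 1 then int t else \<bar>x\<bar>)"
    by (auto simp: simple_refl_def sgn_if)
  then have "odd (inv v \<bar>simple_refl t x\<bar>) = odd (inv v \<bar>x\<bar>)"
    using t by (simp split: if_splits)
  then show ?thesis by (simp only: odd_hyperoct_abs[OF inv_hyperoct[OF v]])
qed

text \<open>The two values whose order is reversed sit at positions of equal parity, so no
  comparison across opposite parities is affected. This covers odd inversions and, with j = i + 1,
  descents.\<close>

lemma simple_refl_comp_less_iff:
  assumes v: "v \<in> hyperoct k" and t: "odd (inv v (int t)) = odd (inv v (int t + 1))" and ij: "odd (i + j)"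
  shows "simple_refl t (v i) < simple_refl t (v j) \<longleftrightarrow> v i < v j"
proof -
  note iv = inv_hyperoct[OF v]
  have i: "inv v (v i) = i" for i using permutes_inverses(2)[OF hyperoct_permutes[OF v]] .
  have par: "odd i \<longleftrightarrow> odd (inv v \<bar>v i\<bar>)" for i
    using odd_hyperoct_abs[OF iv, of "v i"] i by simp
  have "v i \<noteq> v j" "v i \<noteq> - v j"
    using ij hyperoct_eq_iff[OF v] by (auto simp flip: hyperoct_minus[OF v])
  moreover have "\<not> (\<bar>v i\<bar> = int t \<and> \<bar>v j\<bar> = int t + 1 \<or> \<bar>v i\<bar> = int t + 1 \<and> \<bar>v j\<bar> = int t)"
    using par[of i] par[of j] t ij by auto
  ultimately show ?thesis by (subst simple_refl_less_iff) auto
qed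

lemma inv_pairs_odd_simple_refl:
  assumes "v \<in> hyperoct k" "odd (inv v (int t)) = odd (inv v (int t + 1))"
  shows "inv_pairs n (\<lambda>i j. odd (i + j)) (simple_refl t \<circ> v) = inv_pairs n (\<lambda>i j. odd (i + j)) v"
proof -
  have "simple_refl t (v j) < simple_refl t (v i) \<longleftrightarrow> v j < v i" if "odd (i + j)" for i j
    using that by (intro simple_refl_comp_less_iff[OF assms]) (simp add: add.commute)
  then show ?thesis unfolding inv_pairs_def by auto
qed

text \<open>Left multiplication by a generator changes the length by one: the two inversion sets
  differ in a single pair, formed by the positions of t and t + 1.\<close>

lemma odd_card_inv_pairs_simple_refl:
  assumes v: "v \<in> hyperoct k" and t: "t < k"
  shows "odd (card (inv_pairs k (\<lambda>_ _. True) (simple_refl t \<circ> v)) + card (inv_pairs k (\<lambda>_ _. True) v))"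
proof -
  let ?A = "inv_pairs k (\<lambda>_ _. True) v" and ?B = "inv_pairs k (\<lambda>_ _. True) (simple_refl t \<circ> v)"
  note iv = inv_hyperoct[OF v]
  have q: "v i = x \<longleftrightarrow> i = inv v x" for i x
    using permutes_inverses[OF hyperoct_permutes[OF v]] by metis
  have qm: "inv v (- x) = - inv v x" for x by (rule hyperoct_minus[OF iv])
  define a b where "a = inv v (int t)" and "b = inv v (int t + 1)"
  have ab: "\<bar>a\<bar> \<le> int k" "\<bar>b\<bar> \<le> int k"
    using t hyperoct_abs_le_iff[OF iv] by (auto simp: a_def b_def)
  have ab': "a \<noteq> b" "a \<noteq> - b"
    using hyperoct_eq_iff[OF iv] by (auto simp: a_def b_def simp flip: qm)
  have "(simple_refl t (v j) < simple_refl t (v i) \<longleftrightarrow> v j < v i) \<longleftrightarrow>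
        \<not> (j = a \<and> i = b \<or> j = b \<and> i = a \<or> j = - a \<and> i = - b \<or> j = - b \<and> i = - a)"
    if "\<bar>i\<bar> < j" for i j
  proof -
    have "v j \<noteq> v i" "v j \<noteq> - v i"
      using that hyperoct_eq_iff[OF v] by (auto simp: simp flip: hyperoct_minus[OF v])
    moreover have "inv v (- int t - 1) = - b" using qm[of "int t + 1"] by (simp add: b_def)
    ultimately show ?thesis by (subst simple_refl_less_iff) (simp_all add: q a_def b_def qm)
  qed
  then have D: "(i, j) \<in> (?A - ?B) \<union> (?B - ?A) \<longleftrightarrow> \<bar>i\<bar> < j \<and> j \<le> int k \<and>
        (j = a \<and> i = b \<or> j = b \<and> i = a \<or> j = - a \<and> i = - b \<or> j = - b \<and> i = - a)" for i j
    unfolding inv_pairs_def by auto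
  have "\<exists>x. (?A - ?B) \<union> (?B - ?A) = {x}"
  proof -
    \<comment> \<open>Among (a, b), (b, a), (-a, -b), (-b, -a) exactly one has its second entry
      positive and larger than the absolute value of the first.\<close>
    define x where "x = (if \<bar>a\<bar> < \<bar>b\<bar> then (if b > 0 then (a, b) else (- a, - b))
      else (if a > 0 then (b, a) else (- b, - a)))"
    have "(i, j) \<in> (?A - ?B) \<union> (?B - ?A) \<longleftrightarrow> (i, j) = x" for i j
      unfolding D x_def using ab ab' by (auto simp: abs_if split: if_splits)
    then show ?thesis by (intro exI[of _ x]) auto
  qed
  then have "card ((?A - ?B) \<union> (?B - ?A)) = 1" by auto
  moreover have "card ((?A - ?B) \<union> (?B - ?A)) = card (?A - ?B) + card (?B - ?A)"
    by (rule card_Un_disjoint) auto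
  moreover have "card ?A = card (?A \<inter> ?B) + card (?A - ?B)" "card ?B = card (?A \<inter> ?B) + card (?B - ?A)"
    using card_Int_Diff[of ?A ?B] card_Int_Diff[of ?B ?A] by (auto simp: Int_commute)
  ultimately have "card ?B + card ?A = 2 * card (?A \<inter> ?B) + 1" by linarith
  then show ?thesis by simp
qed

lemma weight_comp_simple_refl:
  assumes u: "u \<in> desc_within n {k}" and v: "v \<in> hyperoct k" and kn: "k \<le> n"
    and t: "t < k" "odd (inv v (int t)) = odd (inv v (int t + 1))"
  shows "weight n (u \<circ> (simple_refl t \<circ> v)) = - weight n (u \<circ> v)"
proof -
  let ?s = "simple_refl t" and ?O = "\<lambda>i j :: int. odd (i + j)" and ?T = "\<lambda>_ _ :: int. True"
  note p = permutes_inverses[OF hyperoct_permutes[OF v]]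
  note iv = inv_hyperoct[OF v]
  have sv: "?s \<circ> v \<in> hyperoct k"
    by (rule comp_hyperoct[OF simple_refl_hyperoct v]) (use t in auto)
  have uh: "u \<in> hyperoct n" using u by (simp add: desc_within_def)
  note h = comp_hyperoct[OF uh v kn] comp_hyperoct[OF uh sv kn]
  have "cox_length n (u \<circ> (?s \<circ> v)) = card (inv_pairs k ?T (?s \<circ> v)) + card (inv_pairs n ?T u)"
    unfolding cox_length_eq_card_inv_pairs[OF h(2)] by (rule card_inv_pairs_comp_factor[OF u sv kn]) simp
  moreover have "cox_length n (u \<circ> v) = card (inv_pairs k ?T v) + card (inv_pairs n ?T u)"
    unfolding cox_length_eq_card_inv_pairs[OF h(1)] by (rule card_inv_pairs_comp_factor[OF u v kn]) simp
  ultimately have "odd (cox_length n (u \<circ> (?s \<circ> v)) + cox_length n (u \<circ> v))"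
    using odd_card_inv_pairs_simple_refl[OF v t(1)] by presburger
  then have sgn: "(- 1 :: int poly) ^ cox_length n (u \<circ> (?s \<circ> v)) = - ((- 1) ^ cox_length n (u \<circ> v))"
    by (auto simp: minus_one_power_iff)
  \<comment> \<open>Conjugation by \<open>v\<close> turns the exchange of values into a permutation
    of positions. It preserves parity even though \<open>v\<close> need not, so composing with it on
    the right keeps the number of outer odd pairs.\<close>
  define \<tau> where "\<tau> = inv v \<circ> (?s \<circ> v)"
  have \<tau>: "\<tau> \<in> hyperoct k" unfolding \<tau>_def by (rule comp_hyperoct[OF iv sv]) simp
  have eq: "u \<circ> (?s \<circ> v) = (u \<circ> v) \<circ> \<tau>" by (auto simp: \<tau>_def p)
  have par: "odd (\<tau> i) = odd i" for i
    using odd_inv_simple_refl[OF v t(2), of "v i"] by (simp add: \<tau>_def p)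
  have "card (outer_pairs k n ?O (u \<circ> (?s \<circ> v))) = card (outer_pairs k n ?O (u \<circ> v))"
    unfolding eq using par by (intro card_outer_pairs_comp[OF \<tau>]) simp
  then have "L_stat n (u \<circ> (?s \<circ> v)) = L_stat n (u \<circ> v)"
    unfolding L_stat_eq_card_inv_pairs[OF h(2)] L_stat_eq_card_inv_pairs[OF h(1)]
    by (simp only: card_inv_pairs_comp[OF u sv kn] card_inv_pairs_comp[OF u v kn]
        inv_pairs_odd_simple_refl[OF v t(2)])
  then show ?thesis by (simp add: weight_def sgn)
qed


section \<open>Cancellation of the elements that break parity\<close>

text \<open>Otherwise the parities of the positions of 0, 1, ..., k alternate, starting with 0 at
  position 0. Then the inverse of \<open>v\<close> preserves parity, and so does
  \<open>v\<close>.\<close>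

lemma ex_equal_parity:
  assumes v: "v \<in> hyperoct k" and "\<not> (\<forall>i. odd (v i) = odd i)"
  shows "\<exists>t<k. odd (inv v (int t)) = odd (inv v (int t + 1))"
proof (rule ccontr)
  note iv = inv_hyperoct[OF v]
  assume neg: "\<not> ?thesis"
  have nat: "t \<le> k \<Longrightarrow> odd (inv v (int t)) = odd t" for t
  proof (induction t)
    case 0 show ?case by (simp add: hyperoct_zero[OF iv])
  next
    case (Suc t)
    then have "odd (inv v (int t)) \<noteq> odd (inv v (int t + 1))" using neg by auto
    then show ?case using Suc by (simp add: add.commute)
  qed
  have abs: "odd (inv v \<bar>x\<bar>) = odd \<bar>x\<bar>" for x
  proof (cases "\<bar>x\<bar> \<le> int k")
    case True
    then show ?thesis using nat[of "nat \<bar>x\<bar>"] by (simp add: even_nat_iff)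
  qed (simp add: hyperoct_outside[OF iv])
  have "odd (v i) = odd i" for i
    using abs[of "v i"] odd_hyperoct_abs[OF iv, of "v i"] permutes_inverses[OF hyperoct_permutes[OF v]]
    by simp
  then show False using assms(2) by blast
qed

lemma sum_eq_zero_involution:
  fixes f :: "'a \<Rightarrow> 'b :: {ring_char_0, idom}"
  assumes "\<And>x. x \<in> B \<Longrightarrow> h x \<in> B" "\<And>x. x \<in> B \<Longrightarrow> h (h x) = x" "\<And>x. x \<in> B \<Longrightarrow> f (h x) = - f x"
  shows "sum f B = 0"
proof -
  have "sum f B = sum (\<lambda>x. - f x) B"
    by (rule sum.reindex_bij_witness[of _ h h]) (use assms in auto)
  then have "2 * sum f B = 0" by (simp add: sum_negf)
  then show ?thesis by simp
qed

text \<open>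
  Swapping the values \<open>t\<close> and \<open>t + 1\<close> for the least \<open>t\<close> whose two positions have the same parity
  is a sign-reversing involution, so only parity-preserving permutations contribute.
\<close>

lemma sum_weight_parity_preserving:
  assumes u: "u \<in> desc_within n {k}" and kn: "k \<le> n"
  shows "(\<Sum>v\<in>desc_within k I. weight n (u \<circ> v)) =
    (\<Sum>v\<in>{v \<in> desc_within k I. \<forall>i. odd (v i) = odd i}. weight n (u \<circ> v))"
proof -
  define P where "P = (\<lambda>(v :: int \<Rightarrow> int) t. t < k \<and> odd (inv v (int t)) = odd (inv v (int t + 1)))"
  define h where "h = (\<lambda>v. simple_refl (LEAST t. P v t) \<circ> v)"
  let ?G = "{v \<in> desc_within k I. \<forall>i. odd (v i) = odd i}"
  let ?B = "desc_within k I - ?G"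
  have B: "v \<in> hyperoct k" "P v (LEAST t. P v t)" if "v \<in> ?B" for v
  proof -
    show v: "v \<in> hyperoct k" using that by (simp add: desc_within_def)
    have "\<exists>t. P v t" using ex_equal_parity[OF v] that by (auto simp: P_def)
    then show "P v (LEAST t. P v t)" by (rule LeastI_ex)
  qed
  \<comment> \<open>The swap keeps the whole set of admissible t, so the least one is chosen again
    and the second application undoes the first.\<close>
  have Ph: "P (simple_refl t \<circ> v) = P v" if v: "v \<in> hyperoct k" "P v t" for v t
  proof -
    have "inv (simple_refl t \<circ> v) = inv v \<circ> simple_refl t"
      by (rule inv_unique_comp)
         (use permutes_inverses[OF hyperoct_permutes[OF v(1)]] in \<open>auto simp: fun_eq_iff\<close>)
    moreover have "odd (inv v (simple_refl t x)) = odd (inv v x)" for x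
      using v(2) by (intro odd_inv_simple_refl[OF v(1)]) (simp add: P_def)
    ultimately show ?thesis by (simp add: P_def fun_eq_iff)
  qed
  have "sum (\<lambda>v. weight n (u \<circ> v)) ?B = 0"
  proof (rule sum_eq_zero_involution[where h = h])
    fix v assume v: "v \<in> ?B"
    define t where "t = (LEAST t. P v t)"
    note vh = B(1)[OF v] and Pt = B(2)[OF v, folded t_def]
    have tk: "t < k" and par_t: "odd (inv v (int t)) = odd (inv v (int t + 1))"
      using Pt by (auto simp: P_def)
    have hv: "h v = simple_refl t \<circ> v" by (simp add: h_def t_def)
    have hh: "h v \<in> hyperoct k"
      unfolding hv by (rule comp_hyperoct[OF simple_refl_hyperoct vh]) (use tk in auto)
    have "P (h v) t" unfolding hv Ph[OF vh Pt] by (rule Pt)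
    \<comment> \<open>If \<open>h v\<close> preserved parity, t and t + 1 would sit at positions of
      different parity, against \<open>P (h v) t\<close>.\<close>
    have "\<exists>i. odd (h v i) \<noteq> odd i"
    proof (rule ccontr)
      assume "\<not> ?thesis"
      then have *: "odd (h v i) = odd i" for i by blast
      have "odd (inv (h v) x) = odd x" for x
        using *[of "inv (h v) x"] permutes_inverses[OF hyperoct_permutes[OF hh]] by simp
      then show False using \<open>P (h v) t\<close> by (simp add: P_def)
    qed
    \<comment> \<open>Neighbouring positions have opposite parity, so the swap stays within the
      descent class.\<close>
    moreover have "simple_refl t (v (int i)) < simple_refl t (v (int i + 1)) \<longleftrightarrow> v (int i) < v (int i + 1)" for i
      by (rule simple_refl_comp_less_iff[OF vh par_t]) simp
    ultimately show "h v \<in> ?B" using v hh by (auto simp: desc_within_def hv)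
    have "(LEAST s. P (h v) s) = t"
      using Ph[OF vh Pt] unfolding hv by (simp only: flip: t_def)
    then show "h (h v) = v" by (simp add: h_def[THEN fun_cong, of "h v"]) (simp add: hv fun_eq_iff)
    show "weight n (u \<circ> h v) = - weight n (u \<circ> v)"
      unfolding hv by (rule weight_comp_simple_refl[OF u vh kn tk par_t])
  qed
  then show ?thesis by (subst sum.subset_diff[of ?G]) auto
qed

lemma weight_comp_parity_preserving:
  assumes u: "u \<in> desc_within n {k}" and v: "v \<in> hyperoct k" and kn: "k \<le> n"
    and par: "\<And>i. odd (v i) = odd i"
  shows "weight n (u \<circ> v) = weight n u * weight k v"
proof -
  have uh: "u \<in> hyperoct n" using u by (simp add: desc_within_def)
  note h = comp_hyperoct[OF uh v kn]
  have "cox_length n (u \<circ> v) = cox_length k v + cox_length n u"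
    unfolding cox_length_eq_card_inv_pairs[OF h] cox_length_eq_card_inv_pairs[OF v]
      cox_length_eq_card_inv_pairs[OF uh]
    by (rule card_inv_pairs_comp_factor[OF u v kn]) simp
  moreover have "L_stat n (u \<circ> v) = L_stat k v + L_stat n u"
    unfolding L_stat_eq_card_inv_pairs[OF h] L_stat_eq_card_inv_pairs[OF v]
      L_stat_eq_card_inv_pairs[OF uh]
    using par by (intro card_inv_pairs_comp_factor[OF u v kn]) simp
  ultimately show ?thesis by (simp add: weight_def power_add mult_monom mult_ac add.commute)
qed

definition gen_poly :: "nat \<Rightarrow> nat set \<Rightarrow> int poly" where
  "gen_poly n I = (\<Sum>w\<in>desc_within n I. weight n w)"

lemma sum_weight_comp:
  assumes u: "u \<in> desc_within n {k}" and kn: "k \<le> n"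
  shows "(\<Sum>v\<in>desc_within k I. weight n (u \<circ> v)) = weight n u * gen_poly k I"
proof -
  let ?G = "{v \<in> desc_within k I. \<forall>i. odd (v i) = odd i}"
  \<comment> \<open>The cancellation is used a second time, with \<open>id\<close> in place of
    \<open>u\<close>: it restores the discarded terms after the weight of \<open>u\<close> has been
    split off.\<close>
  have "id \<in> desc_within k {k}" by (auto simp: desc_within_def id_hyperoct)
  from sum_weight_parity_preserving[OF this, of I] have "gen_poly k I = sum (weight k) ?G"
    by (simp add: gen_poly_def)
  moreover have "(\<Sum>v\<in>?G. weight n (u \<circ> v)) = (\<Sum>v\<in>?G. weight n u * weight k v)"
    by (rule sum.cong[OF refl], rule weight_comp_parity_preserving[OF u _ kn]) (auto simp: desc_within_def)
  ultimately show ?thesis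
    using sum_weight_parity_preserving[OF u kn, of I] by (simp add: sum_distrib_left)
qed

section \<open>Standardisation and uniqueness of the factorisation\<close>

text \<open>The standardisation of \<open>w\<close> on [-k, k]: values are replaced by their ranks
  0, ..., 2k, and subtracting k centres these at 0. It recovers the factor \<open>v\<close> from u
  v.\<close>

definition rank_map :: "nat \<Rightarrow> (int \<Rightarrow> int) \<Rightarrow> int \<Rightarrow> int" where
  "rank_map k w i = (if \<bar>i\<bar> \<le> int k then int (card {p \<in> {- int k..int k}. w p < w i}) - int k else i)"

lemma rank_map_less:
  assumes "\<bar>i\<bar> \<le> int k" "\<bar>j\<bar> \<le> int k" "w i < w j"
  shows "rank_map k w i < rank_map k w j"
proof -
  have "card {p \<in> {- int k..int k}. w p < w i} < card {p \<in> {- int k..int k}. w p < w j}"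
  proof (rule psubset_card_mono)
    have "i \<in> {p \<in> {- int k..int k}. w p < w j}" using assms by auto
    then show "{p \<in> {- int k..int k}. w p < w i} \<subset> {p \<in> {- int k..int k}. w p < w j}"
      using assms(3) by fastforce
  qed (rule finite_subset[of _ "{- int k..int k}"], auto)
  then show ?thesis using assms by (simp add: rank_map_def)
qed

lemma rank_map_less_iff:
  assumes "w \<in> hyperoct n" "\<bar>i\<bar> \<le> int k" "\<bar>j\<bar> \<le> int k"
  shows "rank_map k w i < rank_map k w j \<longleftrightarrow> w i < w j"
  using rank_map_less[OF assms(2,3), of w] rank_map_less[OF assms(3,2), of w] hyperoct_eq_iff[OF assms(1), of i j]
  by (cases "w i" "w j" rule: linorder_cases) auto

lemma rank_map_hyperoct:
  assumes w: "w \<in> hyperoct n"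
  shows "rank_map k w \<in> hyperoct k"
proof (rule hyperoctI_inj)
  let ?S = "{- int k..int k}"
  fix i assume i: "\<bar>i\<bar> \<le> int k"
  have "card {p \<in> ?S. w p < w i} \<le> card (?S - {i})"
    by (rule card_mono) auto
  moreover have "i \<in> ?S" using i by auto
  ultimately show "\<bar>rank_map k w i\<bar> \<le> int k"
    using i by (simp add: rank_map_def card_Diff_singleton)
  show "i = j" if "\<bar>j\<bar> \<le> int k" "rank_map k w i = rank_map k w j" for j
  proof -
    have "\<not> w i < w j" "\<not> w j < w i"
      using rank_map_less[OF i that(1), of w] rank_map_less[OF that(1) i, of w] that(2) by auto
    then show ?thesis using hyperoct_eq_iff[OF w, of i j] by simp
  qed
  \<comment> \<open>Oddness: negation turns the values below w(-i) into the values above w(i), and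
    the two counts for i add up to 2k.\<close>
  have "bij_betw uminus {p \<in> ?S. w p < w (- i)} {p \<in> ?S. w i < w p}"
    by (rule bij_betw_byWitness[where f' = uminus]) (auto simp: hyperoct_minus[OF w])
  then have "card {p \<in> ?S. w p < w (- i)} = card {p \<in> ?S. w i < w p}"
    by (rule bij_betw_same_card)
  moreover have "card ?S = card {p \<in> ?S. w p < w i} + card {p \<in> ?S. w i < w p} + 1"
  proof -
    have fin: "finite {p \<in> ?S. Q p}" for Q by (rule finite_subset[of _ ?S]) auto
    have eq: "?S = insert i ({p \<in> ?S. w p < w i} \<union> {p \<in> ?S. w i < w p})"
    proof (intro subset_antisym subsetI)
      fix p assume "p \<in> ?S"
      then show "p \<in> insert i ({p \<in> ?S. w p < w i} \<union> {p \<in> ?S. w i < w p})"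
        using hyperoct_eq_iff[OF w, of p i] by (cases "w p" "w i" rule: linorder_cases) auto
    qed (use i in auto)
    have "card ?S = card (insert i ({p \<in> ?S. w p < w i} \<union> {p \<in> ?S. w i < w p}))"
      by (rule arg_cong[OF eq])
    also have "\<dots> = Suc (card ({p \<in> ?S. w p < w i} \<union> {p \<in> ?S. w i < w p}))"
      by (rule card_insert_disjoint) (intro finite_UnI fin, simp)
    also have "card ({p \<in> ?S. w p < w i} \<union> {p \<in> ?S. w i < w p}) =
        card {p \<in> ?S. w p < w i} + card {p \<in> ?S. w i < w p}"
      by (rule card_Un_disjoint[OF fin fin]) auto
    finally show ?thesis by (simp only: Suc_eq_plus1)
  qed
  ultimately show "rank_map k w (- i) = - rank_map k w i"
    using i by (simp add: rank_map_def)
qed (simp add: rank_map_def)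

text \<open>As \<open>u\<close> is increasing on [-k, k], the rank of u(v(i)) is that of v(i) among
  -k, ..., k, namely v(i) + k.\<close>

lemma rank_map_comp:
  assumes u: "u \<in> desc_within n {k}" and v: "v \<in> hyperoct k" and kn: "k \<le> n"
  shows "rank_map k (u \<circ> v) = v"
proof
  fix i
  let ?S = "{- int k..int k}"
  note m = strict_mono_on_less[OF desc_within_strict_mono_on[OF u kn]]
  note p = permutes_inverses[OF hyperoct_permutes[OF v]]
  note vS = permutes_in_image[OF hyperoct_permutes[OF v]] 
    and ivS = permutes_in_image[OF hyperoct_permutes[OF inv_hyperoct[OF v]]]
  show "rank_map k (u \<circ> v) i = v i"
  proof (cases "i \<in> ?S")
    case True
    then have "{p \<in> ?S. u (v p) < u (v i)} = {p \<in> ?S. v p < v i}"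
      using vS m by auto
    moreover have "bij_betw v {p \<in> ?S. v p < v i} {- int k..< v i}"
    proof (rule bij_betw_byWitness[where f' = "inv v"])
      show "v ` {p \<in> ?S. v p < v i} \<subseteq> {- int k..< v i}"
        using vS by fastforce
      show "inv v ` {- int k..< v i} \<subseteq> {p \<in> ?S. v p < v i}"
      proof (rule image_subsetI)
        fix x assume x: "x \<in> {- int k..< v i}"
        moreover have "v i \<in> ?S" using vS True by simp
        ultimately have "x \<in> ?S" by simp
        then have "inv v x \<in> ?S" by (simp only: ivS)
        then show "inv v x \<in> {p \<in> ?S. v p < v i}" using x by (simp add: p)
      qed
    qed (simp_all add: p)
    ultimately have "card {p \<in> ?S. u (v p) < u (v i)} = card {- int k..< v i}"
      by (simp only: bij_betw_same_card)
    moreover have "v i \<in> ?S" using vS True by simp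
    ultimately show ?thesis using True by (auto simp: rank_map_def)
  qed (use hyperoct_outside[OF v, of i] in \<open>auto simp: rank_map_def\<close>)
qed

lemma comp_desc_within:
  assumes u: "u \<in> desc_within n {k}" and v: "v \<in> desc_within k I" and kn: "k \<le> n"
  shows "u \<circ> v \<in> desc_within n (insert k I)"
proof -
  have uh: "u \<in> hyperoct n" and vh: "v \<in> hyperoct k" using u v by (auto simp: desc_within_def)
  note m = strict_mono_onD[OF desc_within_strict_mono_on[OF u kn]]
  note vS = permutes_in_image[OF hyperoct_permutes[OF vh]] 
  have "u (v (int i)) < u (v (int i + 1))" if "i < n" "i \<noteq> k" "i \<notin> I" for i
  proof (cases "i < k")
    case True
    then have "v (int i) < v (int i + 1)" using v that by (auto simp: desc_within_def)
    then show ?thesis using True vS[of "int i"] vS[of "int i + 1"] by (intro m) auto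
  next
    case False
    then show ?thesis using u that by (auto simp: desc_within_def hyperoct_outside[OF vh])
  qed
  then show ?thesis using comp_hyperoct[OF uh vh kn] by (auto simp: desc_within_def)
qed

lemma comp_inv_rank_map_desc_within:
  assumes w: "w \<in> desc_within n (insert k I)" and kn: "k \<le> n" and I: "I \<subseteq> {..<k}"
  shows "w \<circ> inv (rank_map k w) \<in> desc_within n {k}" "rank_map k w \<in> desc_within k I"
proof -
  have wh: "w \<in> hyperoct n" using w by (simp add: desc_within_def)
  note r = rank_map_hyperoct[OF wh, of k]
  note ir = inv_hyperoct[OF r]
  note p = permutes_inverses[OF hyperoct_permutes[OF r]]
  show "rank_map k w \<in> desc_within k I"
    using r w kn rank_map_less[of "int _" k "int _ + 1" w] by (auto simp: desc_within_def)
  \<comment> \<open>Undoing the standardisation sorts the values on [-k, k]; positions beyond k stay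
    fixed.\<close>
  have "(w \<circ> inv (rank_map k w)) (int i) < (w \<circ> inv (rank_map k w)) (int i + 1)" if "i < n" "i \<noteq> k" for i
  proof (cases "i < k")
    case True
    then show ?thesis
      using rank_map_less_iff[OF wh, of "inv (rank_map k w) (int i)" k "inv (rank_map k w) (int i + 1)"]
        hyperoct_abs_le_iff[OF ir, of "int i"] hyperoct_abs_le_iff[OF ir, of "int i + 1"] p by simp
  next
    case False
    then have "i \<notin> I" using I by auto
    then show ?thesis using that False w by (auto simp: desc_within_def hyperoct_outside[OF ir])
  qed
  then show "w \<circ> inv (rank_map k w) \<in> desc_within n {k}"
    using comp_hyperoct[OF wh ir kn] by (auto simp: desc_within_def)
qed

theorem gen_poly_insert:
  assumes kn: "k \<le> n" and I: "I \<subseteq> {..<k}"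
  shows "gen_poly n (insert k I) = gen_poly n {k} * gen_poly k I"
proof -
  have "gen_poly n (insert k I) =
      (\<Sum>(u, v)\<in>desc_within n {k} \<times> desc_within k I. weight n (u \<circ> v))"
    unfolding gen_poly_def
  proof (rule sum.reindex_bij_witness[of _ "\<lambda>(u, v). u \<circ> v" "\<lambda>w. (w \<circ> inv (rank_map k w), rank_map k w)"])
    fix w assume w: "w \<in> desc_within n (insert k I)"
    then have "w \<in> hyperoct n" by (simp add: desc_within_def)
    from permutes_inverses[OF hyperoct_permutes[OF rank_map_hyperoct[OF this, of k]]]
    have "w \<circ> inv (rank_map k w) \<circ> rank_map k w = w" by (auto simp: fun_eq_iff)
    then show "(case (w \<circ> inv (rank_map k w), rank_map k w) of (u, v) \<Rightarrow> u \<circ> v) = w"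
      "(case (w \<circ> inv (rank_map k w), rank_map k w) of (u, v) \<Rightarrow> weight n (u \<circ> v)) = weight n w" by simp_all
    show "(w \<circ> inv (rank_map k w), rank_map k w) \<in> desc_within n {k} \<times> desc_within k I"
      using comp_inv_rank_map_desc_within[OF w kn I] by simp
  next
    fix x assume "x \<in> desc_within n {k} \<times> desc_within k I"
    then obtain u v where x: "x = (u, v)" "u \<in> desc_within n {k}" "v \<in> desc_within k I" by auto
    then have vh: "v \<in> hyperoct k" by (simp add: desc_within_def)
    show "(case x of (u, v) \<Rightarrow> u \<circ> v) \<in> desc_within n (insert k I)"
      using comp_desc_within[OF x(2,3) kn] x(1) by simp
    show "((case x of (u, v) \<Rightarrow> u \<circ> v) \<circ> inv (rank_map k (case x of (u, v) \<Rightarrow> u \<circ> v)),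
           rank_map k (case x of (u, v) \<Rightarrow> u \<circ> v)) = x"
      using permutes_inverses[OF hyperoct_permutes[OF vh]]
      by (simp add: x(1) rank_map_comp[OF x(2) vh kn]) (simp add: fun_eq_iff)
  qed
  also have "\<dots> = (\<Sum>u\<in>desc_within n {k}. \<Sum>v\<in>desc_within k I. weight n (u \<circ> v))"
    by (simp add: sum.cartesian_product)
  also have "\<dots> = gen_poly n {k} * gen_poly k I"
    using sum_weight_comp[OF _ kn, of _ I] by (simp add: gen_poly_def[of n] sum_distrib_right)
  finally show ?thesis .
qed


subsection \<open>Insertion of the largest entry\<close>

text \<open>The increasing odd map that opens a gap at the positions p and -p;
  \<open>unshift_at\<close> closes it again.\<close>

definition shift_at :: "int \<Rightarrow> int \<Rightarrow> int" where
  "shift_at p i = (if \<bar>i\<bar> < p then i else i + sgn i)"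

definition unshift_at :: "int \<Rightarrow> int \<Rightarrow> int" where
  "unshift_at p i = (if \<bar>i\<bar> < p then i else i - sgn i)"

definition insert_at :: "nat \<Rightarrow> int \<Rightarrow> int \<Rightarrow> (int \<Rightarrow> int) \<Rightarrow> int \<Rightarrow> int" where
  "insert_at m p e w i =
    (if \<bar>i\<bar> > int m + 1 then i else if i = p then e * (int m + 1)
     else if i = - p then - e * (int m + 1) else w (unshift_at p i))"

definition delete_at :: "nat \<Rightarrow> int \<Rightarrow> (int \<Rightarrow> int) \<Rightarrow> int \<Rightarrow> int" where
  "delete_at m p w i = (if \<bar>i\<bar> > int m then i else w (shift_at p i))"

lemma unshift_shift: "p \<ge> 1 \<Longrightarrow> unshift_at p (shift_at p i) = i"
  by (auto simp: shift_at_def unshift_at_def sgn_if)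

lemma shift_unshift: "p \<ge> 1 \<Longrightarrow> \<bar>i\<bar> \<noteq> p \<Longrightarrow> shift_at p (unshift_at p i) = i"
  by (auto simp: shift_at_def unshift_at_def sgn_if)

lemma abs_shift_neq: "p \<ge> 1 \<Longrightarrow> \<bar>shift_at p i\<bar> \<noteq> p"
  by (auto simp: shift_at_def sgn_if)

lemma shift_at_minus: "shift_at p (- i) = - shift_at p i"
  by (auto simp: shift_at_def)

lemma unshift_at_minus: "unshift_at p (- i) = - unshift_at p i"
  by (auto simp: unshift_at_def)

lemma abs_shift_less_iff: "p \<ge> 1 \<Longrightarrow> \<bar>shift_at p i\<bar> < shift_at p j \<longleftrightarrow> \<bar>i\<bar> < j"
  by (auto simp: shift_at_def sgn_if)

lemma abs_unshift_le:
  assumes "1 \<le> p" "p \<le> int m + 1" "\<bar>i\<bar> \<noteq> p" "\<bar>i\<bar> \<le> int m + 1"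
  shows "\<bar>unshift_at p i\<bar> \<le> int m"
  using assms by (auto simp: unshift_at_def sgn_if)

lemma shift_le_iff: 
  assumes "1 \<le> p" "p \<le> int m + 1"
  shows "shift_at p i \<le> 1 + int m \<longleftrightarrow> i \<le> int m"
  using assms by (auto simp: shift_at_def sgn_if)

context
  fixes m :: nat and p e :: int
  assumes p: "1 \<le> p" "p \<le> int m + 1" and e: "\<bar>e\<bar> = 1"
begin

lemma insert_at_at: "insert_at m p e w p = e * (int m + 1)"
  using p by (simp add: insert_at_def)

lemma insert_at_minus_at: "insert_at m p e w (- p) = - e * (int m + 1)"
  using p by (simp add: insert_at_def)

lemma insert_at_other: "\<bar>i\<bar> \<noteq> p \<Longrightarrow> \<bar>i\<bar> \<le> int m + 1 \<Longrightarrow> insert_at m p e w i = w (unshift_at p i)"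
  using p by (auto simp: insert_at_def)

lemma abs_insert_at:
  assumes "\<bar>i\<bar> = p"
  shows "\<bar>insert_at m p e w i\<bar> = int m + 1"
proof -
  have "i = p \<or> i = - p" using assms by linarith
  then show ?thesis using e by (auto simp: insert_at_at insert_at_minus_at abs_mult)
qed

lemma insert_at_abs_le:
  assumes w: "w \<in> hyperoct m" and "\<bar>i\<bar> \<noteq> p" "\<bar>i\<bar> \<le> int m + 1"
  shows "\<bar>insert_at m p e w i\<bar> \<le> int m"
  using hyperoct_abs_le_iff[OF w, of "unshift_at p i"] abs_unshift_le[OF p assms(2,3)]
  by (simp add: insert_at_other[OF assms(2,3)])

lemma insert_at_hyperoct:
  assumes w: "w \<in> hyperoct m"
  shows "insert_at m p e w \<in> hyperoct (Suc m)"
proof (rule hyperoctI_inj)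
  have le: "\<bar>insert_at m p e w i\<bar> \<le> int m" if "\<bar>i\<bar> \<noteq> p" "\<bar>i\<bar> \<le> int (Suc m)" for i
    using that by (intro insert_at_abs_le[OF w]) auto
  fix i assume i: "\<bar>i\<bar> \<le> int (Suc m)"
  show "\<bar>insert_at m p e w i\<bar> \<le> int (Suc m)"
    using le[OF _ i] abs_insert_at[of i w] by (cases "\<bar>i\<bar> = p") auto
  show "insert_at m p e w (- i) = - insert_at m p e w i"
    using i p by (auto simp: insert_at_def unshift_at_minus hyperoct_minus[OF w])
  fix j assume j: "\<bar>j\<bar> \<le> int (Suc m)" and eq: "insert_at m p e w i = insert_at m p e w j"
  have abs: "\<bar>insert_at m p e w i\<bar> = int m + 1 \<longleftrightarrow> \<bar>i\<bar> = p" if "\<bar>i\<bar> \<le> int (Suc m)" for i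
    using le[OF _ that] abs_insert_at[of i w] by (cases "\<bar>i\<bar> = p") auto
  show "i = j"
  proof (cases "\<bar>i\<bar> = p")
    case True
    then have "\<bar>j\<bar> = p" using eq abs[OF i] abs[OF j] by simp
    then have "i = p \<or> i = - p" "j = p \<or> j = - p" using True by linarith+
    then show ?thesis using eq e by (auto simp: insert_at_at insert_at_minus_at)
  next
    case False
    then have jp: "\<bar>j\<bar> \<noteq> p" using eq abs[OF i] abs[OF j] by simp
    then have "w (unshift_at p i) = w (unshift_at p j)"
      using eq False i j by (simp add: insert_at_other)
    then have "unshift_at p i = unshift_at p j" using hyperoct_eq_iff[OF w] by simp
    then show ?thesis using shift_unshift[OF p(1) False] shift_unshift[OF p(1) jp] by metis
  qed
qed (auto simp: insert_at_def)

lemma delete_at_hyperoct: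
  assumes w: "w \<in> hyperoct (Suc m)" and wp: "w p = e * (int m + 1)"
  shows "delete_at m p w \<in> hyperoct m"
proof (rule hyperoctI_inj)
  have em: "\<bar>e * (int m + 1)\<bar> = int m + 1" using e by (simp add: abs_mult)
  have top: "\<bar>i\<bar> = p" if "\<bar>w i\<bar> = int m + 1" for i
  proof -
    have "w i = w p \<or> w i = w (- p)"
      using that em wp hyperoct_minus[OF w, of p] by (auto simp: abs_if split: if_splits)
    then show ?thesis using hyperoct_eq_iff[OF w] p by auto
  qed
  fix i assume i: "\<bar>i\<bar> \<le> int m"
  have "\<bar>shift_at p i\<bar> \<le> int (Suc m)" using i p by (auto simp: shift_at_def sgn_if)
  then have "\<bar>w (shift_at p i)\<bar> \<le> int (Suc m)" using hyperoct_abs_le_iff[OF w] by simp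
  moreover have "\<bar>w (shift_at p i)\<bar> \<noteq> int m + 1" using top abs_shift_neq[OF p(1)] by blast
  ultimately show "\<bar>delete_at m p w i\<bar> \<le> int m" using i by (auto simp: delete_at_def)
  show "delete_at m p w (- i) = - delete_at m p w i"
    using i by (auto simp: delete_at_def shift_at_minus hyperoct_minus[OF w])
  fix j assume j: "\<bar>j\<bar> \<le> int m" and eq: "delete_at m p w i = delete_at m p w j"
  then have "shift_at p i = shift_at p j" using i hyperoct_eq_iff[OF w] by (auto simp: delete_at_def)
  then show "i = j" using unshift_shift[OF p(1)] by metis
qed (auto simp: delete_at_def)

lemma delete_insert:
  assumes w: "w \<in> hyperoct m"
  shows "delete_at m p (insert_at m p e w) = w"
proof
  fix i
  have "\<bar>shift_at p i\<bar> \<le> int m + 1" if "\<bar>i\<bar> \<le> int m"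
    using that p by (auto simp: shift_at_def sgn_if)
  then show "delete_at m p (insert_at m p e w) i = w i"
    using abs_shift_neq[OF p(1), of i] unshift_shift[OF p(1)] p hyperoct_outside[OF w]
    by (auto simp: delete_at_def insert_at_def)
qed

lemma insert_delete:
  assumes w: "w \<in> hyperoct (Suc m)" and wp: "w p = e * (int m + 1)"
  shows "insert_at m p e (delete_at m p w) = w"
proof
  fix i
  show "insert_at m p e (delete_at m p w) i = w i"
  proof (cases "\<bar>i\<bar> = p \<or> \<bar>i\<bar> > int m + 1")
    case True
    then show ?thesis using p wp hyperoct_outside[OF w, of i]
      by (auto simp: insert_at_def hyperoct_minus[OF w] abs_if split: if_splits)
  next
    case False
    then show ?thesis using p abs_unshift_le[OF p, of i] shift_unshift[OF p(1), of i]
      by (auto simp: insert_at_def delete_at_def)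
  qed
qed

lemma insert_at_shift: "\<bar>i\<bar> \<le> int m \<Longrightarrow> insert_at m p e w (shift_at p i) = w i"
  using p abs_shift_neq[OF p(1), of i] unshift_shift[OF p(1), of i]
  by (auto simp: insert_at_def shift_at_def sgn_if split: if_splits)

text \<open>Pairs avoiding p and -p come from \<open>w\<close>. A new maximum at p is inverted with
  every later position and no earlier one. A new minimum at p is inverted with every i with |i| < p,
  and its mirror image, the maximum at -p, with every j > p.\<close>

lemma inv_pairs_insert_at:
  assumes w: "w \<in> hyperoct m"
  shows "inv_pairs (Suc m) R (insert_at m p e w) =
    map_prod (shift_at p) (shift_at p) ` inv_pairs m (\<lambda>i j. R (shift_at p i) (shift_at p j)) w
    \<union> (if e = 1 then Pair p ` {j. p < j \<and> j \<le> int m + 1 \<and> R p j}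
       else (\<lambda>i. (i, p)) ` {i. \<bar>i\<bar> < p \<and> R i p} \<union> Pair (- p) ` {j. p < j \<and> j \<le> int m + 1 \<and> R (- p) j})"
    (is "?L = ?M \<union> ?N")
proof -
  let ?v = "insert_at m p e w"
  have bound: "- int m - 1 < ?v i \<and> ?v i < int m + 1" if "\<bar>i\<bar> \<noteq> p" "\<bar>i\<bar> \<le> int m + 1" for i
    using insert_at_abs_le[OF w that] by auto
  have e': "e = 1 \<or> e = - 1" using e by auto
  have "(i, j) \<in> ?L \<longleftrightarrow> (i, j) \<in> ?M \<union> ?N" for i j
  proof (cases "\<bar>i\<bar> = p \<or> j = p")
    case True
    have "(i, j) \<notin> ?M"
    proof
      assume "(i, j) \<in> ?M"
      then obtain a b where "i = shift_at p a" "j = shift_at p b" by auto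
      then show False using True p(1) abs_shift_neq[OF p(1), of a] abs_shift_neq[OF p(1), of b] by simp
    qed
    moreover have "(i, j) \<in> ?L \<longleftrightarrow> (i, j) \<in> ?N"
    proof -
      consider "j = p" | "i = p" "j \<noteq> p" | "i = - p" "j \<noteq> p" using True by linarith
      then show ?thesis
      proof cases
        case 1
        then show ?thesis using e' bound[of i] p
          by (auto simp: inv_pairs_def insert_at_at image_iff)
      next
        case 2
        then show ?thesis using e' bound[of j] p
          by (auto simp: inv_pairs_def insert_at_at image_iff)
      next
        case 3
        then show ?thesis using e' bound[of j] p
          by (auto simp: inv_pairs_def insert_at_minus_at image_iff)
      qed
    qed
    ultimately show ?thesis by simp
  next
    case False
    then have "(i, j) \<notin> ?N" using p(1) by auto
    moreover have "(i, j) \<in> ?L \<longleftrightarrow> (i, j) \<in> ?M"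
    proof
      assume L: "(i, j) \<in> ?L"
      define a b where "a = unshift_at p i" and "b = unshift_at p j"
      have "\<bar>j\<bar> \<noteq> p" using L False p by (auto simp: inv_pairs_def)
      then have ab: "i = shift_at p a" "j = shift_at p b"
        using False by (auto simp: a_def b_def shift_unshift p)
      have "\<bar>a\<bar> < b" "b \<le> int m" "R (shift_at p a) (shift_at p b)" "?v (shift_at p b) < ?v (shift_at p a)"
        using L by (auto simp: ab inv_pairs_def abs_shift_less_iff[OF p(1)] shift_le_iff[OF p])
      then have "(a, b) \<in> inv_pairs m (\<lambda>i j. R (shift_at p i) (shift_at p j)) w"
        by (auto simp: inv_pairs_def insert_at_shift)
      then show "(i, j) \<in> ?M" by (auto simp: ab)
    next
      assume "(i, j) \<in> ?M"
      then obtain a b where "i = shift_at p a" "j = shift_at p b"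
          "(a, b) \<in> inv_pairs m (\<lambda>i j. R (shift_at p i) (shift_at p j)) w" by auto
      then show "(i, j) \<in> ?L"
        by (auto simp: inv_pairs_def abs_shift_less_iff[OF p(1)] shift_le_iff[OF p] insert_at_shift)
    qed
    ultimately show ?thesis by simp
  qed
  then show ?thesis by auto
qed

lemma card_inv_pairs_insert_at:
  assumes w: "w \<in> hyperoct m"
  shows "card (inv_pairs (Suc m) R (insert_at m p e w)) =
    card (inv_pairs m (\<lambda>i j. R (shift_at p i) (shift_at p j)) w) +
    (if e = 1 then card {j. p < j \<and> j \<le> int m + 1 \<and> R p j}
     else card {i. \<bar>i\<bar> < p \<and> R i p} + card {j. p < j \<and> j \<le> int m + 1 \<and> R (- p) j})"
proof -
  let ?R = "\<lambda>i j. R (shift_at p i) (shift_at p j)"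
  let ?M = "map_prod (shift_at p) (shift_at p) ` inv_pairs m ?R w"
  let ?A = "{j. p < j \<and> j \<le> int m + 1 \<and> R p j}" and ?B = "{i. \<bar>i\<bar> < p \<and> R i p}"
    and ?C = "{j. p < j \<and> j \<le> int m + 1 \<and> R (- p) j}"
  have fin: "finite ?A" "finite ?B" "finite ?C"
    by (rule finite_subset[of _ "{- p..int m + 1}"]; use p in force)+
  have "shift_at p a = shift_at p b \<longleftrightarrow> a = b" for a b
    using unshift_shift[OF p(1)] by metis
  then have M: "card ?M = card (inv_pairs m ?R w)"
    by (intro card_image) (auto simp: inj_on_def)
  have notM: "\<bar>i\<bar> \<noteq> p \<and> j \<noteq> p" if "(i, j) \<in> ?M" for i j
  proof -
    obtain a b where "i = shift_at p a" "j = shift_at p b" using \<open>(i, j) \<in> ?M\<close> by auto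
    then show ?thesis using p(1) abs_shift_neq[OF p(1), of a] abs_shift_neq[OF p(1), of b] by auto
  qed
  show ?thesis
  proof (cases "e = 1")
    case True
    have "card (?M \<union> Pair p ` ?A) = card ?M + card (Pair p ` ?A)"
      using fin notM p by (intro card_Un_disjoint) fastforce+
    moreover have "inv_pairs (Suc m) R (insert_at m p e w) = ?M \<union> Pair p ` ?A"
      unfolding inv_pairs_insert_at[OF w] using True by (simp only: if_True simp_thms)
    moreover have "card (Pair p ` ?A) = card ?A" by (simp add: card_image inj_on_def)
    ultimately show ?thesis using True M by (simp only: if_True simp_thms)
  next
    case False
    have "card (?M \<union> ((\<lambda>i. (i, p)) ` ?B \<union> Pair (- p) ` ?C)) = card ?M + card ((\<lambda>i. (i, p)) ` ?B \<union> Pair (- p) ` ?C)"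
      using fin notM p by (intro card_Un_disjoint) fastforce+
    moreover have "card ((\<lambda>i. (i, p)) ` ?B \<union> Pair (- p) ` ?C) = card ((\<lambda>i. (i, p)) ` ?B) + card (Pair (- p) ` ?C)"
      using fin p by (intro card_Un_disjoint) auto
    moreover have "inv_pairs (Suc m) R (insert_at m p e w) = ?M \<union> ((\<lambda>i. (i, p)) ` ?B \<union> Pair (- p) ` ?C)"
      unfolding inv_pairs_insert_at[OF w] using False by (simp only: if_False simp_thms)
    moreover have "card ((\<lambda>i. (i, p)) ` ?B) = card ?B" "card (Pair (- p) ` ?C) = card ?C"
      by (simp_all add: card_image inj_on_def)
    ultimately show ?thesis using False M by (simp only: if_False simp_thms)
  qed
qed

text \<open>Reindexing by deletion. What remains at each use is that insertion and deletion respect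
  the two descent classes.\<close>

lemma sum_insert_at:
  assumes D: "D \<subseteq> hyperoct m" "D' \<subseteq> hyperoct (Suc m)"
    and ins: "\<And>w. w \<in> D \<Longrightarrow> insert_at m p e w \<in> D'"
    and del: "\<And>w. w \<in> D' \<Longrightarrow> w p = e * (int m + 1) \<Longrightarrow> delete_at m p w \<in> D"
  shows "(\<Sum>w\<in>{w \<in> D'. w p = e * (int m + 1)}. f w) = (\<Sum>w\<in>D. f (insert_at m p e w))"
  by (rule sum.reindex_bij_witness[of _ "insert_at m p e" "delete_at m p"])
     (use D ins del in \<open>auto simp: insert_delete delete_insert insert_at_at subset_iff\<close>)

end


subsection \<open>At most one descent\<close>

text \<open>
  Deleting an entry moves all later positions by one. To compare parities of the original positions
  afterwards, the twist flips the parity of the positions beyond \<open>a\<close>.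
\<close>

definition twisted_parity :: "bool \<Rightarrow> nat \<Rightarrow> int \<Rightarrow> int \<Rightarrow> bool" where
  "twisted_parity t a i j \<longleftrightarrow> odd (i + j) \<noteq> (t \<and> (\<bar>i\<bar> \<le> int a) \<noteq> (\<bar>j\<bar> \<le> int a))"

definition twisted_weight :: "bool \<Rightarrow> nat \<Rightarrow> nat \<Rightarrow> (int \<Rightarrow> int) \<Rightarrow> int poly" where
  "twisted_weight t a n w =
    (- 1) ^ card (inv_pairs n (\<lambda>_ _. True) w) * monom 1 (card (inv_pairs n (twisted_parity t a) w))"

text \<open>Here a and b are the lengths of the two increasing runs, on positions 1..a and
  a+1..a+b.\<close>

definition run_poly :: "bool \<Rightarrow> nat \<Rightarrow> nat \<Rightarrow> int poly" where
  "run_poly t a b = (\<Sum>w\<in>desc_within (a + b) {a}. twisted_weight t a (a + b) w)"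

lemma gen_poly_eq_run_poly: "gen_poly (a + b) {a} = run_poly False a b"
  unfolding gen_poly_def run_poly_def
proof (rule sum.cong[OF refl])
  fix w assume "w \<in> desc_within (a + b) {a}"
  then have w: "w \<in> hyperoct (a + b)" by (simp add: desc_within_def)
  have "twisted_parity False a = (\<lambda>i j. odd (i + j))" by (auto simp: twisted_parity_def fun_eq_iff)
  then show "weight (a + b) w = twisted_weight False a (a + b) w"
    by (simp add: weight_def twisted_weight_def cox_length_eq_card_inv_pairs[OF w] L_stat_eq_card_inv_pairs[OF w])
qed

lemma card_odd_interval: "card {j :: int. x < j \<and> j \<le> x + int m \<and> odd (x + j)} = (m + 1) div 2"
  and card_even_interval: "card {j :: int. x < j \<and> j \<le> x + int m \<and> even (x + j)} = m div 2"
proof (induction m)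
  case 0
  { case 1 show ?case by (auto simp: card_eq_0_iff) }
  { case 2 show ?case by (auto simp: card_eq_0_iff) }
next
  case (Suc m)
  have fin: "finite {j. x < j \<and> j \<le> x + int m \<and> Q j}" for Q
    by (rule finite_subset[of _ "{x..x + int m}"]) auto
  have step: "{j. x < j \<and> j \<le> x + int (Suc m) \<and> Q j} = 
      (if Q (x + int m + 1) then insert (x + int m + 1) {j. x < j \<and> j \<le> x + int m \<and> Q j}
       else {j. x < j \<and> j \<le> x + int m \<and> Q j})" for Q :: "int \<Rightarrow> bool"
  proof -
    have "j \<le> x + int (Suc m) \<longleftrightarrow> j = x + int m + 1 \<or> j \<le> x + int m" for j by auto
    then show ?thesis by auto
  qed
  { case 1 show ?case unfolding step using Suc fin by (auto simp: card_insert_if) }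
  { case 2 show ?case unfolding step using Suc fin by (auto simp: card_insert_if) }
qed

lemma card_int_interval: "card {j :: int. x < j \<and> j \<le> x + int m} = m"
proof -
  have "{j :: int. x < j \<and> j \<le> x + int m} = {x<..x + int m}" by auto
  then show ?thesis by simp
qed

section \<open>Contribution of the entry of largest absolute value\<close>

text \<open>The new entry adds c inversions and d of the pairs counted by the twisted
  \<open>L\<close>. The hypothesis on the shifted parity records which twist describes the remaining
  pairs once the gap is closed.\<close>

lemma twisted_weight_insert_at:
  assumes p: "1 \<le> p" "p \<le> int m + 1" and e: "\<bar>e\<bar> = 1" and w: "w \<in> hyperoct m"
    and R: "\<And>i j. \<bar>i\<bar> < j \<Longrightarrow> j \<le> int m \<Longrightarrow>
      twisted_parity t a (shift_at p i) (shift_at p j) = twisted_parity t' a' i j"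
    and c: "(if e = 1 then card {j. p < j \<and> j \<le> int m + 1}
       else card {i. \<bar>i\<bar> < p} + card {j. p < j \<and> j \<le> int m + 1}) = c"
    and d: "(if e = 1 then card {j. p < j \<and> j \<le> int m + 1 \<and> twisted_parity t a p j}
       else card {i. \<bar>i\<bar> < p \<and> twisted_parity t a i p} +
         card {j. p < j \<and> j \<le> int m + 1 \<and> twisted_parity t a (- p) j}) = d"
  shows "twisted_weight t a (Suc m) (insert_at m p e w) = (- 1) ^ c * monom 1 d * twisted_weight t' a' m w"
proof -
  have "inv_pairs m (\<lambda>i j. twisted_parity t a (shift_at p i) (shift_at p j)) w =
      inv_pairs m (twisted_parity t' a') w"
    using R by (auto simp: inv_pairs_def)
  then have "card (inv_pairs (Suc m) (twisted_parity t a) (insert_at m p e w)) =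
      card (inv_pairs m (twisted_parity t' a') w) + d"
    using card_inv_pairs_insert_at[OF p e w, of "twisted_parity t a"] d by simp
  moreover have "card (inv_pairs (Suc m) (\<lambda>_ _. True) (insert_at m p e w)) =
      card (inv_pairs m (\<lambda>_ _. True) w) + c"
    unfolding c[symmetric] by (simp only: card_inv_pairs_insert_at[OF p e w] simp_thms)
  ultimately show ?thesis
    by (simp add: twisted_weight_def power_add mult_monom mult_ac add.commute)
qed

text \<open>A maximum cannot be followed by an ascent, nor a minimum be preceded by one. The first
  run climbs from w(0) = 0, so a minimum can only open the second run.\<close>

lemma desc_within_top_cases:
  assumes w: "w \<in> desc_within (Suc (a + b)) {a}"
  shows "w (int a + int b + 1) = int (a + b) + 1 \<or> (a \<ge> 1 \<and> w (int a) = int (a + b) + 1)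
    \<or> w (int a + 1) = - (int (a + b) + 1)"
proof -
  define n where "n = int (a + b) + 1"
  have wh: "w \<in> hyperoct (Suc (a + b))" using w by (simp add: desc_within_def)
  note iw = inv_hyperoct[OF wh]
  define q where "q = inv w n"
  have wq: "w q = n" unfolding q_def using permutes_inverses[OF hyperoct_permutes[OF wh]] by simp
  have q: "\<bar>q\<bar> \<le> n" using hyperoct_abs_le_iff[OF wh, of q] wq by (simp add: n_def)
  have bound: "\<bar>w i\<bar> \<le> n" if "\<bar>i\<bar> \<le> n" for i
    using hyperoct_abs_le_iff[OF wh, of i] that by (simp add: n_def)
  have asc: "w i < w (i + 1)" if "0 \<le> i" "i < n" "i \<noteq> int a" for i
    using that by (intro desc_within_ascends[OF w]) (auto simp: n_def)
  have "q \<noteq> 0" using wq hyperoct_zero[OF wh] by (auto simp: n_def)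
  then consider "q > 0" | "q < 0" by linarith
  then show ?thesis
  proof cases
    case 1
    have "q = n \<or> q = int a"
    proof (rule ccontr)
      assume "\<not> (q = n \<or> q = int a)"
      then have "w q < w (q + 1)" "\<bar>q + 1\<bar> \<le> n" using asc[of q] 1 q by auto
      then show False using bound[of "q + 1"] wq by auto
    qed
    then show ?thesis using wq 1 by (auto simp: n_def)
  next
    case 2
    have wq': "w (- q) = - n" using wq hyperoct_minus[OF wh] by simp
    have "- q = int a + 1"
    proof (rule ccontr)
      assume "\<not> - q = int a + 1"
      then have "w (- q - 1) < w (- q - 1 + 1)" using asc[of "- q - 1"] 2 q by auto
      moreover have "\<bar>w (- q - 1)\<bar> \<le> n" using 2 q by (intro bound) auto
      ultimately show False using wq' by auto
    qed
    then show ?thesis using wq' by (auto simp: n_def)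
  qed
qed

lemma sum_top_last:
  "(\<Sum>w\<in>{w \<in> desc_within (Suc (a + b)) {a}. w (int a + int b + 1) = int (a + b) + 1}. twisted_weight t a (Suc (a + b)) w)
    = run_poly t a b"
proof -
  let ?m = "a + b" and ?p = "int a + int b + 1"
  have p: "1 \<le> ?p" "?p \<le> int ?m + 1" and e: "\<bar>1 :: int\<bar> = 1" by auto
  have "(\<Sum>w\<in>{w \<in> desc_within (Suc ?m) {a}. w ?p = 1 * (int ?m + 1)}. twisted_weight t a (Suc ?m) w)
    = (\<Sum>w\<in>desc_within ?m {a}. twisted_weight t a (Suc ?m) (insert_at ?m ?p 1 w))"
  proof (rule sum_insert_at[OF p e])
    fix w assume w: "w \<in> desc_within ?m {a}"
    then have wh: "w \<in> hyperoct ?m" by (simp add: desc_within_def)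
    have "insert_at ?m ?p 1 w (int i) < insert_at ?m ?p 1 w (int i + 1)" if "i < Suc ?m" "i \<noteq> a" for i
    proof (cases "i = ?m")
      case True
      then show ?thesis using hyperoct_abs_le_iff[OF wh, of "int ?m"] by (auto simp: insert_at_def unshift_at_def)
    next
      case False
      then show ?thesis using that w by (auto simp: insert_at_def unshift_at_def desc_within_def)
    qed
    then show "insert_at ?m ?p 1 w \<in> desc_within (Suc ?m) {a}"
      using insert_at_hyperoct[OF p e wh] by (simp add: desc_within_def)
  next
    fix w assume w: "w \<in> desc_within (Suc ?m) {a}" "w ?p = 1 * (int ?m + 1)"
    then have wh: "w \<in> hyperoct (Suc ?m)" by (simp add: desc_within_def)
    show "delete_at ?m ?p w \<in> desc_within ?m {a}"
      using delete_at_hyperoct[OF p e wh w(2)] w(1) by (auto simp: desc_within_def delete_at_def shift_at_def)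
  qed (auto simp: desc_within_def)
  also have "\<dots> = (\<Sum>w\<in>desc_within ?m {a}. (- 1) ^ 0 * monom 1 0 * twisted_weight t a ?m w)"
  proof (rule sum.cong[OF refl], rule twisted_weight_insert_at[OF p e])
    have "{j. ?p < j \<and> j \<le> int ?m + 1} = {}"
      "{j. ?p < j \<and> j \<le> int ?m + 1 \<and> twisted_parity t a ?p j} = {}" by auto
    then show "(if (1::int) = 1 then card {j. ?p < j \<and> j \<le> int ?m + 1}
       else card {i. \<bar>i\<bar> < ?p} + card {j. ?p < j \<and> j \<le> int ?m + 1}) = 0"
      "(if (1::int) = 1 then card {j. ?p < j \<and> j \<le> int ?m + 1 \<and> twisted_parity t a ?p j}
       else card {i. \<bar>i\<bar> < ?p \<and> twisted_parity t a i ?p} +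
         card {j. ?p < j \<and> j \<le> int ?m + 1 \<and> twisted_parity t a (- ?p) j}) = 0"
      by (simp_all only: if_True refl card.empty)
  qed (auto simp: desc_within_def shift_at_def)
  finally show ?thesis by (simp add: run_poly_def)
qed

text \<open>All b + 1 positions of the second run are inverted with position a; those at odd
  distance count for \<open>L\<close>, or at even distance under the twist. Once the maximum is
  deleted, the permitted descent moves to a - 1.\<close>

lemma sum_top_first_run:
  assumes a: "a \<ge> 1"
  shows "(\<Sum>w\<in>{w \<in> desc_within (Suc (a + b)) {a}. w (int a) = int (a + b) + 1}. twisted_weight t a (Suc (a + b)) w)
    = (- 1) ^ (b + 1) * monom 1 (if t then (b + 1) div 2 else (b + 2) div 2) * run_poly (\<not> t) (a - 1) (b + 1)"
proof -
  let ?m = "a + b" and ?p = "int a"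
  let ?d = "if t then (b + 1) div 2 else (b + 2) div 2"
  have p: "1 \<le> ?p" "?p \<le> int ?m + 1" and e: "\<bar>1 :: int\<bar> = 1" using a by auto
  have "(\<Sum>w\<in>{w \<in> desc_within (Suc ?m) {a}. w ?p = 1 * (int ?m + 1)}. twisted_weight t a (Suc ?m) w)
    = (\<Sum>w\<in>desc_within ?m {a - 1}. twisted_weight t a (Suc ?m) (insert_at ?m ?p 1 w))"
  proof (rule sum_insert_at[OF p e])
    fix w assume w: "w \<in> desc_within ?m {a - 1}"
    then have wh: "w \<in> hyperoct ?m" by (simp add: desc_within_def)
    have asc: "w i < w (i + 1)" if "0 \<le> i" "i < int ?m" "i \<noteq> int a - 1" for i
      using that a by (intro desc_within_ascends[OF w]) auto
    have "insert_at ?m ?p 1 w (int i) < insert_at ?m ?p 1 w (int i + 1)" if "i < Suc ?m" "i \<noteq> a" for i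
    proof -
      consider "i + 1 < a" | "i + 1 = a" | "a < i" using \<open>i \<noteq> a\<close> by linarith
      then show ?thesis
      proof cases
        case 1
        then show ?thesis using asc[of "int i"] by (auto simp: insert_at_def unshift_at_def)
      next
        case 2
        then show ?thesis using hyperoct_abs_le_iff[OF wh, of "int i"] by (auto simp: insert_at_def unshift_at_def)
      next
        case 3
        then show ?thesis using asc[of "int i - 1"] that by (auto simp: insert_at_def unshift_at_def)
      qed
    qed
    then show "insert_at ?m ?p 1 w \<in> desc_within (Suc ?m) {a}"
      using insert_at_hyperoct[OF p e wh] by (simp add: desc_within_def)
  next
    fix w assume w: "w \<in> desc_within (Suc ?m) {a}" "w ?p = 1 * (int ?m + 1)"
    then have wh: "w \<in> hyperoct (Suc ?m)" by (simp add: desc_within_def)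
    have asc: "w i < w (i + 1)" if "0 \<le> i" "i < int ?m + 1" "i \<noteq> int a" for i
      using that by (intro desc_within_ascends[OF w(1)]) auto
    have "delete_at ?m ?p w (int i) < delete_at ?m ?p w (int i + 1)" if "i < ?m" "i \<noteq> a - 1" for i
    proof -
      consider "i + 1 < a" | "a \<le> i" using \<open>i \<noteq> a - 1\<close> by linarith
      then show ?thesis
        using asc[of "int i"] asc[of "int i + 1"] that p
        by cases (auto simp: delete_at_def shift_at_def add.assoc)
    qed
    then show "delete_at ?m ?p w \<in> desc_within ?m {a - 1}"
      using delete_at_hyperoct[OF p e wh w(2)] by (auto simp: desc_within_def)
  qed (auto simp: desc_within_def)
  also have "\<dots> = (\<Sum>w\<in>desc_within ?m {a - 1}. (- 1) ^ (b + 1) * monom 1 ?d * twisted_weight (\<not> t) (a - 1) ?m w)"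
  proof (rule sum.cong[OF refl], rule twisted_weight_insert_at[OF p e])
    have "{j. ?p < j \<and> j \<le> int ?m + 1} = {j. ?p < j \<and> j \<le> ?p + int (b + 1)}" by auto
    then show "(if (1::int) = 1 then card {j. ?p < j \<and> j \<le> int ?m + 1}
       else card {i. \<bar>i\<bar> < ?p} + card {j. ?p < j \<and> j \<le> int ?m + 1}) = b + 1"
      by (simp only: card_int_interval if_True refl)
    have "{j. ?p < j \<and> j \<le> int ?m + 1 \<and> twisted_parity t a ?p j} =
       (if t then {j. ?p < j \<and> j \<le> ?p + int (b + 1) \<and> even (?p + j)}
        else {j. ?p < j \<and> j \<le> ?p + int (b + 1) \<and> odd (?p + j)})"
      by (auto simp: twisted_parity_def)
    then show "(if (1::int) = 1 then card {j. ?p < j \<and> j \<le> int ?m + 1 \<and> twisted_parity t a ?p j}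
       else card {i. \<bar>i\<bar> < ?p \<and> twisted_parity t a i ?p} +
         card {j. ?p < j \<and> j \<le> int ?m + 1 \<and> twisted_parity t a (- ?p) j}) = ?d"
      by (simp only: card_odd_interval card_even_interval if_distrib[of card] refl if_True) simp
    fix i j :: int
    \<comment> \<open>Closing the gap flips parity exactly for the positions beyond the new boundary
      a - 1, which toggles the twist.\<close>
    have "\<bar>shift_at ?p x\<bar> \<le> int a \<longleftrightarrow> \<bar>x\<bar> \<le> int (a - 1)"
      "odd (shift_at ?p x) \<longleftrightarrow> odd x \<noteq> (\<not> \<bar>x\<bar> \<le> int (a - 1))" for x
      using p by (auto simp: shift_at_def sgn_if)
    then show "twisted_parity t a (shift_at ?p i) (shift_at ?p j) = twisted_parity (\<not> t) (a - 1) i j"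
      by (simp add: twisted_parity_def) blast
  qed (auto simp: desc_within_def)
  finally show ?thesis using a by (simp add: run_poly_def sum_distrib_left)
qed

text \<open>The minimum at a + 1 is inverted with the 2a + 1 positions of [-a, a], and its mirror
  image with the b later positions; hence the sign exponent 2a + 1 + b. Of the 2a + 1 positions, a +
  1 lie at odd distance from a + 1 and a at even distance; the twist selects the latter.\<close>

lemma sum_top_negative:
  "(\<Sum>w\<in>{w \<in> desc_within (Suc (a + b)) {a}. w (int a + 1) = - (int (a + b) + 1)}. twisted_weight t a (Suc (a + b)) w)
    = (- 1) ^ (b + 1) * monom 1 ((b + 1) div 2 + (if t then a else a + 1)) * run_poly (\<not> t) a b"
proof -
  let ?m = "a + b" and ?p = "int a + 1"
  let ?d = "(b + 1) div 2 + (if t then a else a + 1)"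
  have p: "1 \<le> ?p" "?p \<le> int ?m + 1" and e: "\<bar>- 1 :: int\<bar> = 1" by auto
  have "(\<Sum>w\<in>{w \<in> desc_within (Suc ?m) {a}. w ?p = - 1 * (int ?m + 1)}. twisted_weight t a (Suc ?m) w)
    = (\<Sum>w\<in>desc_within ?m {a}. twisted_weight t a (Suc ?m) (insert_at ?m ?p (- 1) w))"
  proof (rule sum_insert_at[OF p e])
    fix w assume w: "w \<in> desc_within ?m {a}"
    then have wh: "w \<in> hyperoct ?m" by (simp add: desc_within_def)
    have asc: "w i < w (i + 1)" if "0 \<le> i" "i < int ?m" "i \<noteq> int a" for i
      using that by (intro desc_within_ascends[OF w]) auto
    have "insert_at ?m ?p (- 1) w (int i) < insert_at ?m ?p (- 1) w (int i + 1)" if "i < Suc ?m" "i \<noteq> a" for i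
    proof -
      consider "i < a" | "i = a + 1" | "a + 1 < i" using \<open>i \<noteq> a\<close> by linarith
      then show ?thesis
      proof cases
        case 1
        then show ?thesis using asc[of "int i"] by (auto simp: insert_at_def unshift_at_def)
      next
        case 2
        then show ?thesis using that hyperoct_abs_le_iff[OF wh, of "int i"]
          by (auto simp: insert_at_def unshift_at_def)
      next
        case 3
        then show ?thesis using asc[of "int i - 1"] that by (auto simp: insert_at_def unshift_at_def)
      qed
    qed
    then show "insert_at ?m ?p (- 1) w \<in> desc_within (Suc ?m) {a}"
      using insert_at_hyperoct[OF p e wh] by (simp add: desc_within_def)
  next
    fix w assume w: "w \<in> desc_within (Suc ?m) {a}" "w ?p = - 1 * (int ?m + 1)"
    then have wh: "w \<in> hyperoct (Suc ?m)" by (simp add: desc_within_def)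
    have asc: "w i < w (i + 1)" if "0 \<le> i" "i < int ?m + 1" "i \<noteq> int a" for i
      using that by (intro desc_within_ascends[OF w(1)]) auto
    have "delete_at ?m ?p w (int i) < delete_at ?m ?p w (int i + 1)" if "i < ?m" "i \<noteq> a" for i
    proof -
      consider "i < a" | "a < i" using \<open>i \<noteq> a\<close> by linarith
      then show ?thesis
        using asc[of "int i"] asc[of "int i + 1"] that p
        by cases (auto simp: delete_at_def shift_at_def add.assoc)
    qed
    then show "delete_at ?m ?p w \<in> desc_within ?m {a}"
      using delete_at_hyperoct[OF p e wh w(2)] by (auto simp: desc_within_def)
  qed (auto simp: desc_within_def)
  also have "\<dots> = (\<Sum>w\<in>desc_within ?m {a}. (- 1) ^ (2 * a + 1 + b) * monom 1 ?d * twisted_weight (\<not> t) a ?m w)"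
  proof (rule sum.cong[OF refl], rule twisted_weight_insert_at[OF p e])
    have J: "?p < j \<and> j \<le> int ?m + 1 \<longleftrightarrow> ?p < j \<and> j \<le> ?p + int b" for j by auto
    \<comment> \<open>The symmetric interval is rewritten as half-open from -(a + 1); this starting
      point has the parity of a + 1, so the interval counts apply.\<close>
    have I: "\<bar>i\<bar> < ?p \<longleftrightarrow> - ?p < i \<and> i \<le> - ?p + int (2 * a + 1)" for i by auto
    show "(if (- 1::int) = 1 then card {j. ?p < j \<and> j \<le> int ?m + 1}
       else card {i. \<bar>i\<bar> < ?p} + card {j. ?p < j \<and> j \<le> int ?m + 1}) = 2 * a + 1 + b"
      unfolding I J card_int_interval by simp
    \<comment> \<open>Both -(a + 1) and j lie beyond the boundary a, so the twist does not act on
      these pairs.\<close>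
    have "{j. ?p < j \<and> j \<le> int ?m + 1 \<and> twisted_parity t a (- ?p) j} =
        {j. ?p < j \<and> j \<le> ?p + int b \<and> odd (?p + j)}"
      by (auto simp: twisted_parity_def)
    then have "card {j. ?p < j \<and> j \<le> int ?m + 1 \<and> twisted_parity t a (- ?p) j} = (b + 1) div 2"
      by (simp only: card_odd_interval)
    moreover have "{i. \<bar>i\<bar> < ?p \<and> twisted_parity t a i ?p} =
        (if t then {i. - ?p < i \<and> i \<le> - ?p + int (2 * a + 1) \<and> even (- ?p + i)}
         else {i. - ?p < i \<and> i \<le> - ?p + int (2 * a + 1) \<and> odd (- ?p + i)})"
      by (auto simp: twisted_parity_def)
    then have "card {i. \<bar>i\<bar> < ?p \<and> twisted_parity t a i ?p} = (if t then a else a + 1)"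
      by (simp only: card_odd_interval card_even_interval if_distrib[of card]) simp
    ultimately show "(if (- 1::int) = 1 then card {j. ?p < j \<and> j \<le> int ?m + 1 \<and> twisted_parity t a ?p j}
       else card {i. \<bar>i\<bar> < ?p \<and> twisted_parity t a i ?p} +
         card {j. ?p < j \<and> j \<le> int ?m + 1 \<and> twisted_parity t a (- ?p) j}) = ?d"
      by simp
    fix i j :: int
    have "\<bar>shift_at ?p x\<bar> \<le> int a \<longleftrightarrow> \<bar>x\<bar> \<le> int a"
      "odd (shift_at ?p x) \<longleftrightarrow> odd x \<noteq> (\<not> \<bar>x\<bar> \<le> int a)" for x
      by (auto simp: shift_at_def sgn_if)
    then show "twisted_parity t a (shift_at ?p i) (shift_at ?p j) = twisted_parity (\<not> t) a i j"
      by (simp add: twisted_parity_def) blast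
  qed (auto simp: desc_within_def)
  finally show ?thesis by (simp add: run_poly_def sum_distrib_left power_add)
qed

text \<open>
  The entry of largest absolute value ends one of the two runs or, if it is negative, starts the
  second one.
\<close>

lemma run_poly_Suc:
  "run_poly t a (Suc b) = run_poly t a b
    + (if a = 0 then 0 else (- 1) ^ (b + 1) * monom 1 (if t then (b + 1) div 2 else (b + 2) div 2)
        * run_poly (\<not> t) (a - 1) (b + 1))
    + (- 1) ^ (b + 1) * monom 1 ((b + 1) div 2 + (if t then a else a + 1)) * run_poly (\<not> t) a b"
proof -
  let ?D = "desc_within (Suc (a + b)) {a}" and ?f = "twisted_weight t a (Suc (a + b))"
  let ?n = "int (a + b) + 1"
  let ?A = "{w \<in> ?D. w (int a + int b + 1) = ?n}" and ?B = "if a = 0 then {} else {w \<in> ?D. w (int a) = ?n}"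
    and ?C = "{w \<in> ?D. w (int a + 1) = - ?n}"
  have h: "w \<in> hyperoct (Suc (a + b))" if "w \<in> ?D" for w using that by (simp add: desc_within_def)
  have "?A \<inter> ?B = {}"
  proof (rule equals0I)
    fix w assume "w \<in> ?A \<inter> ?B"
    then have "w \<in> ?D" "w (int a) = w (int a + int b + 1)" by (auto split: if_splits)
    then show False using hyperoct_eq_iff[OF h] by simp
  qed
  moreover have "(?A \<union> ?B) \<inter> ?C = {}"
  proof (rule equals0I)
    fix w assume w: "w \<in> (?A \<union> ?B) \<inter> ?C"
    then have wh: "w \<in> hyperoct (Suc (a + b))" by (auto intro: h)
    have "w (int a + int b + 1) = - w (int a + 1) \<or> w (int a) = - w (int a + 1)"
      using w by (auto split: if_splits)
    then show False
      by (auto simp: hyperoct_eq_iff[OF wh] simp flip: hyperoct_minus[OF wh])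
  qed
  moreover have "?D = ?A \<union> ?B \<union> ?C"
  proof (intro subset_antisym subsetI)
    fix w assume "w \<in> ?D"
    then show "w \<in> ?A \<union> ?B \<union> ?C" using desc_within_top_cases[of w a b] by auto
  qed (auto split: if_splits)
  moreover have "finite ?A" "finite ?B" "finite ?C" by auto
  ultimately have "sum ?f ?D = sum ?f ?A + sum ?f ?B + sum ?f ?C"
    by (metis (no_types, lifting) finite_UnI sum.union_disjoint)
  moreover have "run_poly t a (Suc b) = sum ?f ?D" by (simp add: run_poly_def)
  moreover have "sum ?f ?B = (if a = 0 then 0 else (- 1) ^ (b + 1) * monom 1 (if t then (b + 1) div 2 else (b + 2) div 2)
        * run_poly (\<not> t) (a - 1) (b + 1))"
  proof (cases "a = 0")
    case False
    then have "a \<ge> 1" by simp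
    from sum_top_first_run[OF this] False show ?thesis by (simp only: if_False)
  qed simp
  ultimately show ?thesis by (simp only: sum_top_last sum_top_negative)
qed


subsection \<open>Closed form\<close>

text \<open>The denominator that a run of length b contributes to \<open>f_poly\<close>.\<close>

definition even_fact :: "nat \<Rightarrow> int poly" where
  "even_fact b = (\<Prod>s=1..b div 2. und (2 * s))"

lemma und_fact_Suc: "und_fact (Suc n) = und_fact n * und (Suc n)"
  by (simp add: und_fact_def)

lemma und_pos: "m > 0 \<Longrightarrow> und m = 1 - monom 1 m"
  by (simp add: und_def)

lemma und_neq_zero: "und m \<noteq> 0"
proof (cases "m = 0")
  case False
  have "coeff (und m) m = - 1" using False by (simp add: und_def)
  then show ?thesis by auto
qed (simp add: und_def)

lemma und_fact_neq_zero: "und_fact n \<noteq> 0"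
  by (simp add: und_fact_def und_neq_zero)

lemma even_fact_neq_zero: "even_fact n \<noteq> 0"
  by (simp add: even_fact_def und_neq_zero)

text \<open>Uniqueness of the factorisation applied to id = w o inv w = id o id.\<close>

lemma desc_within_self: "desc_within a {a} = {id}"
proof -
  have id: "id \<in> desc_within a {a}" by (auto simp: desc_within_def id_hyperoct)
  moreover have "w = id" if w: "w \<in> desc_within a {a}" for w
  proof -
    have wh: "w \<in> hyperoct a" using w by (simp add: desc_within_def)
    note p = permutes_inverses[OF hyperoct_permutes[OF wh]]
    have "w \<circ> inv w = id" using p by auto
    then have "inv w = id"
      using rank_map_comp[OF w inv_hyperoct[OF wh]] rank_map_comp[OF id id_hyperoct] by simp
    then show ?thesis using p(2) by (auto simp: fun_eq_iff)
  qed
  ultimately show ?thesis by blast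
qed

lemma run_poly_0: "run_poly t a 0 = 1"
proof -
  have "inv_pairs a R id = {}" for R by (auto simp: inv_pairs_def)
  then show ?thesis
    by (simp add: run_poly_def desc_within_self twisted_weight_def del: id_apply)
qed

lemma even_fact_Suc_even: "even b \<Longrightarrow> even_fact (Suc b) = even_fact b"
  by (simp add: even_fact_def)

lemma even_fact_Suc_odd: "odd b \<Longrightarrow> even_fact (Suc b) = even_fact b * und (Suc b)"
  by (elim oddE) (simp add: even_fact_def)

text \<open>For b + 1 the recursion calls (a, b) and (a - 1, b + 1), in both twists; hence an outer
  induction on b and an inner one on a. Clearing denominators keeps the identities inside
  Z[X].\<close>

lemma run_poly_closed_form:
  "und_fact a * even_fact b * run_poly False a b = und_fact (a + b) \<and>
   und_fact a * even_fact b * run_poly True a b = (if odd b then 0 else monom 1 (b div 2) * und_fact (a + b))"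
proof (induction b arbitrary: a)
  case 0
  show ?case by (simp add: run_poly_0 even_fact_def)
next
  case (Suc b)
  note IHb = Suc
  show ?case
  proof (induction a rule: less_induct)
    case (less a)
    define A D D' B where "A = und_fact a" and "D = even_fact b" and "D' = even_fact (Suc b)" and "B = und_fact (a + b)"
    define H T where "H = run_poly False a b" and "T = run_poly True a b"
    \<comment> \<open>For a = 0 the value 0 fits the common formula, whose factor 1 - r is then 1 -
      X^0 = 0.\<close>
    define H1 T1 where "H1 = (if a = 0 then 0 else run_poly False (a - 1) (b + 1))"
      and "T1 = (if a = 0 then 0 else run_poly True (a - 1) (b + 1))"
    define r x :: "int poly" where "r = monom 1 a" and "x = monom 1 1"
    note defs = A_def D_def D'_def B_def H_def T_def H1_def T1_def r_def x_def
    have H: "A * D * H = B" and T: "A * D * T = (if odd b then 0 else monom 1 (b div 2) * B)"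
      using IHb[of a] by (simp_all add: defs)
    have pred: "A * D' * H1 = (1 - r) * B"
      "A * D' * T1 = (if even b then 0 else monom 1 (Suc b div 2) * ((1 - r) * B))"
    proof -
      consider "a = 0" | a' where "a = Suc a'" by (cases a) auto
      then have "A * D' * H1 = (1 - r) * B \<and>
        A * D' * T1 = (if even b then 0 else monom 1 (Suc b div 2) * ((1 - r) * B))"
      proof cases
        case 1
        then show ?thesis by (simp add: defs)
      next
        case 2
        then have A: "A = (1 - r) * und_fact a'" by (simp add: defs und_fact_Suc und_pos)
        have "A * D' * H1 = (1 - r) * (und_fact a' * D' * run_poly False a' (Suc b))"
          "A * D' * T1 = (1 - r) * (und_fact a' * D' * run_poly True a' (Suc b))"
          using 2 by (simp_all add: A H1_def T1_def mult_ac)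
        moreover have "und_fact a' * D' * run_poly False a' (Suc b) = B"
          "und_fact a' * D' * run_poly True a' (Suc b) = (if even b then 0 else monom 1 (Suc b div 2) * B)"
          using less[of a'] 2 by (simp_all add: D'_def B_def)
        ultimately show ?thesis by (simp only:) (simp add: mult.left_commute)
      qed
      then show "A * D' * H1 = (1 - r) * B"
        "A * D' * T1 = (if even b then 0 else monom 1 (Suc b div 2) * ((1 - r) * B))" by auto
    qed
    have "A * D' * run_poly False a (Suc b) = und_fact (a + Suc b) \<and>
      A * D' * run_poly True a (Suc b) = (if odd (Suc b) then 0 else monom 1 (Suc b div 2) * und_fact (a + Suc b))"
    proof (cases "even b")
      case True
      then obtain c where b: "b = 2 * c" by auto
      \<comment> \<open>With r = X^a and x = X, the product r q q x is X^(a+b+1), the power in the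
        next factor of \<open>und_fact\<close>.\<close>
      define q :: "int poly" where "q = monom 1 c"
      have rec: "run_poly False a (Suc b) = H - q * x * T1 - q * r * x * T"
        "run_poly True a (Suc b) = T - q * H1 - q * r * H"
        by (simp_all add: run_poly_Suc b defs q_def mult_monom add_ac)
      have fact: "und_fact (a + Suc b) = B * (1 - r * q * q * x)"
        by (simp add: defs q_def und_fact_Suc und_pos mult_monom b mult_2 add_ac)
      have D': "D' = D" using True by (simp add: defs even_fact_Suc_even)
      have T': "A * D * T = q * B" using T by (simp add: b q_def)
      have pred': "A * D * H1 = (1 - r) * B" "A * D * T1 = 0" using pred True unfolding D' by simp_all
      have "A * D * run_poly False a (Suc b) = A * D * H - q * x * (A * D * T1) - q * r * x * (A * D * T)"
        unfolding rec by (simp only: algebra_simps)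
      also have "\<dots> = und_fact (a + Suc b)"
        unfolding H T' pred' fact by (simp add: algebra_simps)
      finally have 1: "A * D * run_poly False a (Suc b) = und_fact (a + Suc b)" .
      \<comment> \<open>The coefficients of B are q, -q (1 - r) and -q r: they cancel, which is the
        vanishing for odd run length.\<close>
      have "A * D * run_poly True a (Suc b) = A * D * T - q * (A * D * H1) - q * r * (A * D * H)"
        unfolding rec by (simp only: algebra_simps)
      also have "\<dots> = 0"
        unfolding H T' pred' by (simp add: algebra_simps)
      finally show ?thesis using 1 True by (simp add: D')
    next
      case False
      then obtain c where b: "b = 2 * c + 1" by (auto elim: oddE)
      define q :: "int poly" where "q = monom 1 (c + 1)"
      have rec: "run_poly False a (Suc b) = H + q * T1 + q * r * x * T"
        "run_poly True a (Suc b) = T + q * H1 + q * r * H"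
        by (simp_all add: run_poly_Suc b defs q_def mult_monom add_ac)
      have fact: "und_fact (a + Suc b) = B * (1 - r * q * q)"
        by (simp add: defs q_def und_fact_Suc und_pos mult_monom b mult_2 add_ac)
      \<comment> \<open>Only the step from odd to even run length adds a factor to the denominator,
        here 1 - q^2 = 1 - X^(b+1).\<close>
      have "D' = D * (1 - q * q)"
        using False by (simp add: defs even_fact_Suc_odd q_def und_pos mult_monom b mult_2 add_ac)
      then have AD: "A * D' * z = (1 - q * q) * (A * D * z)" for z by (simp only: mult_ac)
      have q: "monom 1 (Suc b div 2) = q" by (simp add: b q_def)
      have T': "A * D * T = 0" using T False by simp
      have pred': "A * D' * T1 = q * ((1 - r) * B)" using pred(2) False unfolding q by simp
      \<comment> \<open>The computation rests on (1 - q^2) + q^2 (1 - r) = 1 - q^2 r; in the twisted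
        case, on (1 - r) + r (1 - q^2) = 1 - r q^2.\<close>
      have "A * D' * run_poly False a (Suc b) = A * D' * H + q * (A * D' * T1) + q * r * x * (A * D' * T)"
        unfolding rec by (simp only: algebra_simps)
      also have "\<dots> = und_fact (a + Suc b)"
        unfolding pred' unfolding AD H T' fact by (simp add: algebra_simps)
      finally have 1: "A * D' * run_poly False a (Suc b) = und_fact (a + Suc b)" .
      have "A * D' * run_poly True a (Suc b) = A * D' * T + q * (A * D' * H1) + q * r * (A * D' * H)"
        unfolding rec by (simp only: algebra_simps)
      also have "\<dots> = q * und_fact (a + Suc b)"
        unfolding pred unfolding AD H T' fact by (simp add: algebra_simps)
      finally show ?thesis using 1 False q by simp
    qed
    then show ?case by (simp add: defs)
  qed
qed

section \<open>Assembly of the formula for arbitrary descent classes\<close>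

lemma gen_poly_singleton:
  assumes "a \<le> n"
  shows "und_fact a * even_fact (n - a) * gen_poly n {a} = und_fact n"
  using run_poly_closed_form[of a "n - a"] gen_poly_eq_run_poly[of a "n - a"] assms by simp

lemma gen_poly_empty: "gen_poly n {} = 1"
proof -
  \<comment> \<open>Position n is never tested for an ascent, so the empty class is the case of a
    second run of length 0.\<close>
  have "desc_within n {} = desc_within n {n}" by (auto simp: desc_within_def)
  then have "gen_poly n {} = gen_poly (n + 0) {n}" by (simp add: gen_poly_def)
  then show ?thesis by (simp only: gen_poly_eq_run_poly run_poly_0)
qed

lemma f_poly_empty: "f_poly n {} = 1"
  by (simp add: f_poly_def und_fact_neq_zero)

text \<open>With k the new largest index, the leading quotient splits at \<open>und_fact k\<close>,
  and the product gains one factor, for the last run of length n - k. This mirrors the factorisation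
  of \<open>gen_poly\<close>.\<close>

lemma f_poly_insert:
  assumes fin: "finite I" and less: "\<And>i. i \<in> I \<Longrightarrow> i < k" and kn: "k \<le> n"
  shows "f_poly n (insert k I) =
    to_fract (und_fact n) / to_fract (und_fact k) / to_fract (even_fact (n - k)) * f_poly k I"
proof -
  have "sorted_list_of_set (insert k I) = sorted_list_of_set I @ [k]"
    using fin less
    by (intro sorted_distinct_set_unique) (auto simp: sorted_append simp del: sorted_list_of_set_insert_remove intro: less_imp_le)
  then have idx: "idx_list n (insert k I) = idx_list k I @ [n]" by (simp add: idx_list_def)
  have len: "length (idx_list k I) = Suc (card I)" "idx_list k I ! card I = k"
    by (simp_all add: idx_list_def nth_append)
  \<comment> \<open>The end marker n of the longer list gives way to k, which is the end marker for
    \<open>I\<close>; this includes empty \<open>I\<close>.\<close>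
  have min: "Min (insert k I \<union> {n}) = Min (I \<union> {k})"
  proof -
    have "Min (I \<union> {k}) \<le> k" using fin by (intro Min_le) auto
    moreover have "insert k I \<union> {n} = insert n (I \<union> {k})" by auto
    moreover have "Min (insert n (I \<union> {k})) = min n (Min (I \<union> {k}))"
      using fin by (intro Min_insert) auto
    ultimately show ?thesis using kn by (simp only: min_absorb2 order_trans[OF _ kn])
  qed
  let ?g = "\<lambda>xs :: nat list. \<lambda>r. \<Prod>s=1..(xs ! Suc r - xs ! r) div 2. inverse (to_fract (und (2 * s)))"
  have "k \<notin> I" using less by blast
  then have "(\<Prod>r<card (insert k I). ?g (idx_list n (insert k I)) r) =
      (\<Prod>r<card I. ?g (idx_list k I @ [n]) r) * ?g (idx_list k I @ [n]) (card I)"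
    using fin by (simp add: idx)
  also have "(\<Prod>r<card I. ?g (idx_list k I @ [n]) r) = (\<Prod>r<card I. ?g (idx_list k I) r)"
    by (rule prod.cong[OF refl]) (simp add: nth_append len)
  also have "?g (idx_list k I @ [n]) (card I) = inverse (to_fract (even_fact (n - k)))"
  proof -
    have "to_fract (prod f S) = (\<Prod>s\<in>S. to_fract (f s))" for f :: "nat \<Rightarrow> int poly" and S
      by (induction S rule: infinite_finite_induct) auto
    then show ?thesis by (simp add: nth_append len even_fact_def prod_inversef[unfolded comp_def, symmetric])
  qed
  finally show ?thesis
    unfolding f_poly_def min by (simp add: field_simps und_fact_neq_zero)
qed

text \<open>Splitting off the largest index k leaves an instance in B_k rather than B_n, so the
  induction on \<open>I\<close> must keep n arbitrary.\<close>

theorem gen_poly_eq_f_poly: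
  assumes "I \<subseteq> {..<n}"
  shows "to_fract (gen_poly n I) = f_poly n I"
proof -
  have "finite I" using assms finite_subset by blast
  then show ?thesis using assms
  proof (induction I arbitrary: n rule: finite_linorder_max_induct)
    case empty
    show ?case by (simp add: gen_poly_empty f_poly_empty)
  next
    case (insert k I)
    then have k: "k < n" "I \<subseteq> {..<k}" by auto
    have "to_fract (und_fact k) * to_fract (even_fact (n - k)) * to_fract (gen_poly n {k}) = to_fract (und_fact n)"
      using gen_poly_singleton[of k n] k by (simp flip: to_fract_mult)
    then have "to_fract (gen_poly n {k}) = to_fract (und_fact n) / to_fract (und_fact k) / to_fract (even_fact (n - k))"
      by (simp add: field_simps und_fact_neq_zero even_fact_neq_zero)
    then show ?case
      using gen_poly_insert[of k n I] k insert by (simp add: f_poly_insert)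
  qed
qed

theorem theorem1p2:
  fixes n :: nat and I :: "nat set"
  assumes "n \<ge> 1"
    and "I \<subseteq> {0..n - 1}"
    and "I = {0} \<or> I = {0..n - 1} \<or> (even n \<and> (\<forall>i\<in>I. even i))"
  shows "to_fract (\<Sum>w\<in>{w \<in> hyperoct n. descent_set n w \<subseteq> I}.
           (- 1) ^ cox_length n w * monom (1 :: int) (L_stat n w)) = f_poly n I"
proof -
  have "I \<subseteq> {..<n}" using assms(1,2) by auto
  from gen_poly_eq_f_poly[OF this] show ?thesis
    unfolding gen_poly_def weight_def desc_within_eq .
qed

end
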